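(* Let $\sigma^2>0$, $2\le M_R\le M_T$, let $\mathbf\Phi\in\mathbb R^{M_R\times M_T}$ with $\mathrm{vec}(\mathbf\Phi)\sim\mathcal N(\mathbf 0,\sigma^2\mathbf I_{M_TM_R})$, $\tilde{\mathbf\Theta}=\mathbf 1_{M_R,M_T}+j\mathbf\Phi$, and $M_d=M_T-M_R$. Then $$\det(\tilde{\mathbf\Theta}\tilde{\mathbf\Theta}^H)\overset{d}{=}\Big(\chi^2_{M_d+1,\sigma^2}+M_TM_R\,\beta\big(\tfrac{M_d+1}{2},\tfrac{M_R-1}{2}\big)\Big)\prod_{i=1}^{M_R-1}\chi^2_{M_T-i+1,\sigma^2},$$ where the chi-square variables are mutually statistically independent and $\beta(a,b)$ is a beta-distributed random variable. Symmetrically, for $2\le M_T<M_R$ with $M_d=M_R-M_T$: $\det(\tilde{\mathbf\Theta}^H\tilde{\mathbf\Theta})\overset{d}{=}\big(\chi^2_{M_d+1,\sigma^2}+M_TM_R\,\beta(\tfrac{M_d+1}{2},\tfrac{M_T-1}{2})\big)\prod_{i=1}^{M_T-1}\chi^2_{M_R-i+1,\sigma^2}$.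
   Context: $\mathbf 1_{m,n}$ is the all-ones $m\times n$ matrix. For an integer $n\ge1$ and $s>0$, $\chi^2_{n,s}$ denotes a random variable distributed as $\|\mathbf x\|^2$ with $\mathbf x\sim\mathcal N(\mathbf 0,s\mathbf I_n)$. $\beta(a,b)$ has density $\frac{\Gamma(a+b)}{\Gamma(a)\Gamma(b)}x^{a-1}(1-x)^{b-1}$ on $[0,1]$. $\overset{d}{=}$ denotes equality in distribution. *)

theory Defs
  imports "HOL-Probability.Probability" "Jordan_Normal_Form.Schur_Decomposition"
begin

definition gauss_var :: "real \<Rightarrow> real measure" where
  "gauss_var s = density lborel (normal_density 0 (sqrt s))"

definition chi2 :: "nat \<Rightarrow> real \<Rightarrow> real measure" where
  "chi2 n s = distr (PiM {..<n} (\<lambda>_. gauss_var s)) borel (\<lambda>x. \<Sum>i<n. (x i)\<^sup>2)"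

definition beta_density :: "real \<Rightarrow> real \<Rightarrow> real \<Rightarrow> ennreal" where
  "beta_density a b x = ennreal (indicator {0..1} x *
     (Gamma (a + b) / (Gamma a * Gamma b)) * x powr (a - 1) * (1 - x) powr (b - 1))"

definition beta_dist :: "real \<Rightarrow> real \<Rightarrow> real measure" where
  "beta_dist a b = density lborel (beta_density a b)"

definition Phi_law :: "nat \<Rightarrow> nat \<Rightarrow> real \<Rightarrow> (nat \<times> nat \<Rightarrow> real) measure" where
  "Phi_law MR MT s = PiM ({..<MR} \<times> {..<MT}) (\<lambda>_. gauss_var s)"

definition Theta :: "nat \<Rightarrow> nat \<Rightarrow> (nat \<times> nat \<Rightarrow> real) \<Rightarrow> complex mat" where
  "Theta MR MT \<Phi> = mat MR MT (\<lambda>(r, t). 1 + \<i> * complex_of_real (\<Phi> (r, t)))"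

text \<open>Law of (chi^2_{Md+1,s} + MT*MR*beta((Md+1)/2,(K-1)/2)) * prod_{i=1}^{K-1} chi^2_{N-i+1,s}
  with all variables independent: index 0 is the first chi-square, index 1 the beta variable,
  index i+1 (1 <= i <= K-1) the i-th chi-square of the product.
  Here K = min(M_R,M_T), N = max(M_R,M_T), Md = N - K.\<close>
definition rhs_law :: "nat \<Rightarrow> nat \<Rightarrow> real \<Rightarrow> real measure" where
  "rhs_law K N s =
     distr (PiM {..K} (\<lambda>i. if i = 0 then chi2 (N - K + 1) s
                           else if i = 1 then beta_dist ((real (N - K) + 1) / 2) ((real K - 1) / 2)
                           else chi2 (N - (i - 1) + 1) s))
       borel
       (\<lambda>y. (y 0 + real N * real K * y 1) * (\<Prod>i\<in>{1..K - 1}. y (i + 1)))"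

end

theory Submission
  imports Defs
begin

text \<open>Write \<open>\<Theta> = A + i \<Phi>\<close> with \<open>A\<close> the all-ones matrix. The Gaussian law of \<open>\<Phi>\<close> is
  invariant under orthogonal maps on either side, so \<open>A\<close> may be replaced by the matrix whose only
  nonzero entry is \<open>t = sqrt (M\<^sub>T M\<^sub>R)\<close> in the corner. Condition on the last row \<open>\<phi>\<close> and rotate the
  columns so that \<open>\<phi>\<close> becomes \<open>\<parallel>\<phi>\<parallel>\<close> times the last basis vector: the Gram determinant splits off the
  factor \<open>\<parallel>\<phi>\<parallel>\<^sup>2\<close>, and what remains is the same problem with one row and one column less and with
  \<open>t\<^sup>2\<close> replaced by \<open>t\<^sup>2 (1 - \<phi>\<^sub>0\<^sup>2 / \<parallel>\<phi>\<parallel>\<^sup>2)\<close>. Here \<open>\<parallel>\<phi>\<parallel>\<^sup>2\<close> is a chi-square variable, independent of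
  \<open>1 - \<phi>\<^sub>0\<^sup>2 / \<parallel>\<phi>\<parallel>\<^sup>2\<close>, which has law \<open>\<beta>((n - 1)/2, 1/2)\<close> in dimension \<open>n\<close>; the beta variables met along
  the way multiply up to a single one because \<open>\<beta>(a, b) \<cdot> \<beta>(a + b, c)\<close> has law \<open>\<beta>(a, b + c)\<close>.\<close>

subsection \<open>Gamma and beta distributions\<close>

text \<open>Equality in law is tested by integrals of Borel functions \<open>f\<close> with values
  in \<open>ennreal\<close>. Tonelli then permits every reordering without integrability, and the
  factor \<open>r\<close> split off at each step is absorbed by passing to
  \<open>\<lambda>z. f (r * z)\<close>; this is why the induction ranges over all \<open>f\<close>
  and all corner entries \<open>t\<close>. The test functions live on the complex numbers, so the
  determinant need not first be turned into a real number. Orthogonal maps are finite products of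
  plane rotations, so that invariance of the Gaussian product measure comes down to a substitution
  in two real variables. Each step removes one row and one column, so their difference stays fixed.
  The sum in the first factor of the result comes from the end of the recursion: for a single row
  the determinant is the squared norm of its Gaussian part, a chi-square variable, plus the square
  of what is left of \<open>t\<close>. The beta variables arrive with parameters (n - 1)/2, (n -
  2)/2, ... and 1/2; each first parameter is the sum of both parameters of the next one, so their
  product telescopes.\<close>

definition gamma_density :: "real \<Rightarrow> real \<Rightarrow> real \<Rightarrow> ennreal" where
  "gamma_density s a x = ennreal (indicator {0<..} x *
     (x powr (a - 1) * exp (- x / (2 * s)) / (Gamma a * (2 * s) powr a)))"

text \<open>The scale is \<open>2 * s\<close>, so that the square of a centred normal variable of
  variance \<open>s\<close> has shape \<open>1 / 2\<close> and \<open>chi2 n s\<close> has shape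
  \<open>n / 2\<close>.\<close>

definition gamma_dist :: "real \<Rightarrow> real \<Rightarrow> real measure" where
  "gamma_dist s a = density lborel (gamma_density s a)"

lemma measurable_gamma_density [measurable]: "gamma_density s a \<in> borel_measurable borel"
  unfolding gamma_density_def by measurable

lemma measurable_beta_density [measurable]: "beta_density a b \<in> borel_measurable borel"
  unfolding beta_density_def by measurable

lemma sets_gamma_dist [measurable_cong, simp]: "sets (gamma_dist s a) = sets borel"
  by (simp add: gamma_dist_def)

lemma sets_beta_dist [measurable_cong, simp]: "sets (beta_dist a b) = sets borel"
  by (simp add: beta_dist_def)

lemma sets_gauss_var [measurable_cong, simp]: "sets (gauss_var s) = sets borel"
  by (simp add: gauss_var_def)

lemma sets_chi2 [measurable_cong, simp]: "sets (chi2 n s) = sets borel"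
  by (simp add: chi2_def)

lemma space_gauss_var [simp]: "space (gauss_var s) = UNIV"
  by (simp add: gauss_var_def)

lemma nn_integral_gamma_dist:
  assumes [measurable]: "h \<in> borel_measurable borel"
  shows "(\<integral>\<^sup>+x. h x \<partial>gamma_dist s a) = (\<integral>\<^sup>+x. gamma_density s a x * h x \<partial>lborel)"
  unfolding gamma_dist_def by (subst nn_integral_density) auto

lemma nn_integral_beta_dist:
  assumes [measurable]: "h \<in> borel_measurable borel"
  shows "(\<integral>\<^sup>+x. h x \<partial>beta_dist a b) = (\<integral>\<^sup>+x. beta_density a b x * h x \<partial>lborel)"
  unfolding beta_dist_def by (subst nn_integral_density) auto

lemma sigma_finite_gamma_dist: "sigma_finite_measure (gamma_dist s a)"
  unfolding gamma_dist_def
  by (subst sigma_finite_measure.sigma_finite_iff_density_finite[OF sigma_finite_lborel]) (auto simp: gamma_density_def)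

lemma sigma_finite_beta_dist: "sigma_finite_measure (beta_dist a b)"
  unfolding beta_dist_def
  by (subst sigma_finite_measure.sigma_finite_iff_density_finite[OF sigma_finite_lborel]) (auto simp: beta_density_def)

lemma nn_integral_lborel_shift:
  fixes t :: real
  assumes [measurable]: "f \<in> borel_measurable borel"
  shows "(\<integral>\<^sup>+x. f x \<partial>lborel) = (\<integral>\<^sup>+x. f (t + x) \<partial>lborel)"
  using nn_integral_real_affine[of f 1 t] by simp

lemma nn_integral_lborel_scale:
  fixes c :: real
  assumes [measurable]: "f \<in> borel_measurable borel" and "c \<noteq> 0"
  shows "(\<integral>\<^sup>+x. f x \<partial>lborel) = (\<integral>\<^sup>+x. ennreal \<bar>c\<bar> * f (c * x) \<partial>lborel)"
  using nn_integral_real_affine[of f c 0] assms by (simp add: nn_integral_cmult)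

lemma prob_space_beta_dist:
  assumes "a > 0" "b > 0"
  shows "prob_space (beta_dist a b)"
proof
  define C where "C = Gamma (a + b) / (Gamma a * Gamma b)"
  have C: "C > 0" using assms by (simp add: C_def)
  have CB: "C * Beta a b = 1"
    using assms Gamma_real_pos[of a, THEN less_imp_neq] Gamma_real_pos[of b, THEN less_imp_neq]
      Gamma_real_pos[of "a + b", THEN less_imp_neq]
    by (simp add: C_def Beta_def)
  let ?f = "\<lambda>t. t powr (a - 1) * (1 - t) powr (b - 1)"
  have "((\<lambda>t. C * ?f t) has_integral 1) {0..1}"
    using has_integral_mult_right[OF has_integral_Beta_real[OF assms], of C] CB by simp
  then have "((\<lambda>t. if t \<in> {0..1} then C * ?f t else 0) has_integral 1) UNIV"
    by (subst has_integral_restrict_UNIV)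
  then have "integral\<^sup>N lborel (\<lambda>t. ennreal (if t \<in> {0..1} then C * ?f t else 0)) = ennreal 1"
    by (intro nn_integral_has_integral_lborel) (use C in auto)
  also have "(\<lambda>t. ennreal (if t \<in> {0..1} then C * ?f t else 0)) = beta_density a b"
    by (auto simp: beta_density_def C_def fun_eq_iff mult.assoc)
  finally show "emeasure (beta_dist a b) (space (beta_dist a b)) = 1"
    unfolding beta_dist_def by (subst emeasure_density) (auto simp: beta_density_def)
qed

lemma prob_space_gamma_dist:
  assumes "a > 0" "s > 0"
  shows "prob_space (gamma_dist s a)"
proof
  have "gamma_density s a \<in> borel_measurable borel" by measurable
  then have "integral\<^sup>N lborel (gamma_density s a)
      = (\<integral>\<^sup>+x. ennreal \<bar>2 * s\<bar> * gamma_density s a (2 * s * x) \<partial>lborel)"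
    using assms by (intro nn_integral_lborel_scale) auto
  also have "\<dots> = (\<integral>\<^sup>+x. ennreal (if x \<in> {0..} then inverse (Gamma a) * (x powr (a - 1) / exp x) else 0) \<partial>lborel)"
  proof (intro nn_integral_cong)
    fix x :: real
    consider "x < 0" | "x = 0" | "x > 0" by linarith
    then show "ennreal \<bar>2 * s\<bar> * gamma_density s a (2 * s * x)
        = ennreal (if x \<in> {0..} then inverse (Gamma a) * (x powr (a - 1) / exp x) else 0)"
    proof cases
      case 3
      have "(2 * s) powr a = (2 * s) * (2 * s) powr (a - 1)"
        using assms by (simp add: powr_diff)
      moreover have "(2 * s * x) powr (a - 1) = (2 * s) powr (a - 1) * x powr (a - 1)"
        using assms 3 by (simp add: powr_mult)
      ultimately show ?thesis
        using assms 3 by (simp add: gamma_density_def ennreal_mult[symmetric] exp_minus divide_simps mult_ac)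
    qed (use assms in \<open>auto simp: gamma_density_def mult_pos_neg not_less mult_le_0_iff split: split_indicator\<close>)
  qed
  also have "\<dots> = ennreal 1"
  proof (intro nn_integral_has_integral_lborel)
    have "((\<lambda>t. inverse (Gamma a) * (t powr (a - 1) / exp t)) has_integral inverse (Gamma a) * Gamma a) {0..}"
      by (intro has_integral_mult_right Gamma_integral_real assms)
    then show "((\<lambda>x. if x \<in> {0..} then inverse (Gamma a) * (x powr (a - 1) / exp x) else 0) has_integral 1) UNIV"
      using Gamma_real_pos[OF assms(1)] by (subst has_integral_restrict_UNIV) simp
  qed (use Gamma_real_pos[OF assms(1)] in auto)
  finally show "emeasure (gamma_dist s a) (space (gamma_dist s a)) = 1"
    by (simp add: gamma_dist_def emeasure_density)
qed

text \<open>The change from \<open>(x, y)\<close> to \<open>r = x + y\<close>,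
  \<open>u = x / (x + y)\<close> is made one variable at a time: \<open>y = r - x\<close> for fixed
  \<open>x\<close>, then Tonelli, then \<open>x = r * u\<close> for fixed \<open>r\<close>. The
  product of the two densities separates in \<open>r\<close> and \<open>u\<close>; this is the
  source of the independence of norm and angle.\<close>

lemma nn_integral_gamma_gamma:
  fixes h :: "real \<Rightarrow> real \<Rightarrow> ennreal"
  assumes a: "a > 0" and b: "b > 0" and s: "s > 0"
    and [measurable]: "(\<lambda>(r, u). h r u) \<in> borel_measurable (borel \<Otimes>\<^sub>M borel)"
  shows "(\<integral>\<^sup>+x. \<integral>\<^sup>+y. h (x + y) (x / (x + y)) \<partial>gamma_dist s b \<partial>gamma_dist s a)
       = (\<integral>\<^sup>+r. \<integral>\<^sup>+u. h r u \<partial>beta_dist a b \<partial>gamma_dist s (a + b))"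
proof -
  let ?g = "gamma_density s"
  have "(\<integral>\<^sup>+x. \<integral>\<^sup>+y. h (x + y) (x / (x + y)) \<partial>gamma_dist s b \<partial>gamma_dist s a)
      = (\<integral>\<^sup>+x. ?g a x * (\<integral>\<^sup>+y. ?g b y * h (x + y) (x / (x + y)) \<partial>lborel) \<partial>lborel)"
    using sigma_finite_gamma_dist[of s b]
    by (subst nn_integral_gamma_dist; (subst nn_integral_gamma_dist)?)
      (auto intro!: sigma_finite_measure.borel_measurable_nn_integral)
  also have "\<dots> = (\<integral>\<^sup>+x. ?g a x * (\<integral>\<^sup>+r. ?g b (r - x) * h r (x / r) \<partial>lborel) \<partial>lborel)"
  proof -
    have "(\<integral>\<^sup>+y. ?g b y * h (x + y) (x / (x + y)) \<partial>lborel) = (\<integral>\<^sup>+r. ?g b (r - x) * h r (x / r) \<partial>lborel)" for x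
      by (subst nn_integral_lborel_shift[where t = "- x"]) auto
    then show ?thesis by simp
  qed
  also have "\<dots> = (\<integral>\<^sup>+x. \<integral>\<^sup>+r. ?g a x * (?g b (r - x) * h r (x / r)) \<partial>lborel \<partial>lborel)"
    by (intro nn_integral_cong nn_integral_cmult[symmetric]) auto
  also have "\<dots> = (\<integral>\<^sup>+r. \<integral>\<^sup>+x. ?g a x * (?g b (r - x) * h r (x / r)) \<partial>lborel \<partial>lborel)"
    by (intro lborel_pair.Fubini') auto
  also have "\<dots> = (\<integral>\<^sup>+r. \<integral>\<^sup>+u. ?g (a + b) r * (beta_density a b u * h r u) \<partial>lborel \<partial>lborel)"
  proof (rule nn_integral_cong)
    fix r :: real
    show "(\<integral>\<^sup>+x. ?g a x * (?g b (r - x) * h r (x / r)) \<partial>lborel)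
        = (\<integral>\<^sup>+u. ?g (a + b) r * (beta_density a b u * h r u) \<partial>lborel)"
    proof (cases "r > 0")
      case False
      then have "?g a x * (?g b (r - x) * h r (x / r)) = 0" for x
        by (auto simp: gamma_density_def split: split_indicator)
      moreover have "?g (a + b) r = 0"
        using False by (auto simp: gamma_density_def)
      ultimately show ?thesis
        by (subst nn_integral_cong[of lborel _ "\<lambda>_. 0"]) auto
    next
      case True
      have "(\<integral>\<^sup>+x. ?g a x * (?g b (r - x) * h r (x / r)) \<partial>lborel)
          = (\<integral>\<^sup>+u. ennreal \<bar>r\<bar> * (?g a (r * u) * (?g b (r - r * u) * h r (r * u / r))) \<partial>lborel)"
        using True by (intro nn_integral_lborel_scale) auto
      also have "\<dots> = (\<integral>\<^sup>+u. ?g (a + b) r * (beta_density a b u * h r u) \<partial>lborel)"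
      proof (intro nn_integral_cong)
        fix u :: real
        \<comment> \<open>The leading \<open>r\<close> is the Jacobian of \<open>x = r * u\<close>.
          The exponents belonging to \<open>r * u\<close> and \<open>r * (1 - u)\<close> add up to
          one in \<open>r\<close> alone, so that only powers of \<open>u\<close> and
          \<open>1 - u\<close> remain.\<close>
        have "ennreal r * (?g a (r * u) * ?g b (r - r * u)) = ?g (a + b) r * beta_density a b u"
        proof (cases "0 < u \<and> u < 1")
          case u: True
          have *: "r - r * u = r * (1 - u)" by (simp add: algebra_simps)
          have p1: "r * u > 0" "r * (1 - u) > 0" using True u by auto
          have e: "exp (- (r * u) / (2 * s)) * exp (- (r * (1 - u)) / (2 * s)) = exp (- r / (2 * s))"
            by (simp add: exp_add[symmetric] add_divide_distrib[symmetric] algebra_simps)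
          have p: "r * ((r * u) powr (a - 1) * (r * (1 - u)) powr (b - 1))
              = r powr (a + b - 1) * (u powr (a - 1) * (1 - u) powr (b - 1))"
          proof -
            have "r * (r powr (a - 1) * r powr (b - 1)) = r powr (a + b - 1)"
              using True by (simp add: powr_mult_base powr_add[symmetric] mult.assoc[symmetric])
            then show ?thesis
              using True u by (simp add: powr_mult mult_ac)
          qed
          have q: "(2 * s) powr a * (2 * s) powr b = (2 * s) powr (a + b)"
            by (simp add: powr_add)
          let ?L = "r * (((r * u) powr (a - 1) * exp (- (r * u) / (2 * s)) / (Gamma a * (2 * s) powr a)) *
              ((r * (1 - u)) powr (b - 1) * exp (- (r * (1 - u)) / (2 * s)) / (Gamma b * (2 * s) powr b)))"
          let ?R = "(r powr (a + b - 1) * exp (- r / (2 * s)) / (Gamma (a + b) * (2 * s) powr (a + b))) *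
              ((Gamma (a + b) / (Gamma a * Gamma b)) * u powr (a - 1) * (1 - u) powr (b - 1))"
          have "?L = (r * ((r * u) powr (a - 1) * (r * (1 - u)) powr (b - 1))) *
              (exp (- (r * u) / (2 * s)) * exp (- (r * (1 - u)) / (2 * s))) /
              (Gamma a * Gamma b * ((2 * s) powr a * (2 * s) powr b))"
            by (simp add: mult_ac)
          also have "\<dots> = ?R"
            unfolding p e q using Gamma_real_pos[of "a + b", THEN less_imp_neq] a b by (simp add: mult_ac)
          finally have "?L = ?R" .
          moreover have "ennreal r * (?g a (r * u) * ?g b (r - r * u)) = ennreal ?L"
            unfolding * gamma_density_def using p1 True a b s
            by (subst ennreal_mult[symmetric], simp, simp)+ simp
          moreover have "?g (a + b) r * beta_density a b u = ennreal ?R"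
            unfolding gamma_density_def beta_density_def using True u a b s
            by (subst ennreal_mult[symmetric]) auto
          ultimately show ?thesis by simp
        next
          case False
          then have "u \<le> 0 \<or> u \<ge> 1" by auto
          then have "r * u \<le> 0 \<or> r - r * u \<le> 0"
            using True by (auto simp: mult_le_0_iff)
          then have "?g a (r * u) * ?g b (r - r * u) = 0"
            by (auto simp: gamma_density_def split: split_indicator)
          \<comment> \<open>At the end points 0 and 1 the density vanishes by the convention that
            \<open>0 powr _\<close> is 0.\<close>
          moreover have "beta_density a b u = 0"
            using False by (auto simp: beta_density_def not_less less_le split: split_indicator)
          ultimately show ?thesis by simp
        qed
        then show "ennreal \<bar>r\<bar> * (?g a (r * u) * (?g b (r - r * u) * h r (r * u / r)))
            = ?g (a + b) r * (beta_density a b u * h r u)"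
          using True by (simp add: mult.assoc[symmetric])
      qed
      finally show ?thesis .
    qed
  qed
  also have "\<dots> = (\<integral>\<^sup>+r. ?g (a + b) r * (\<integral>\<^sup>+u. beta_density a b u * h r u \<partial>lborel) \<partial>lborel)"
    by (intro nn_integral_cong nn_integral_cmult) auto
  also have "\<dots> = (\<integral>\<^sup>+r. \<integral>\<^sup>+u. h r u \<partial>beta_dist a b \<partial>gamma_dist s (a + b))"
    using sigma_finite_beta_dist[of a b]
    by (subst nn_integral_gamma_dist; (subst nn_integral_beta_dist)?)
      (auto intro!: sigma_finite_measure.borel_measurable_nn_integral)
  finally show ?thesis .
qed

text \<open>The density of a product at \<open>z\<close> is the integral over \<open>v\<close> of
  the density of \<open>v\<close> times that of \<open>z / v\<close>, divided by \<open>v\<close>.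
  After an affine substitution for \<open>v\<close> this integrand is the target density at
  \<open>z\<close> times the density of the law with parameters \<open>b\<close> and
  \<open>c\<close>, which has total mass 1.\<close>

lemma nn_integral_beta_beta:
  fixes h :: "real \<Rightarrow> ennreal"
  assumes a: "a > 0" and b: "b > 0" and c: "c > 0"
    and [measurable]: "h \<in> borel_measurable borel"
  shows "(\<integral>\<^sup>+v. \<integral>\<^sup>+u. h (v * u) \<partial>beta_dist a b \<partial>beta_dist (a + b) c) = (\<integral>\<^sup>+z. h z \<partial>beta_dist a (b + c))"
proof -
  let ?B = beta_density
  interpret bc: prob_space "beta_dist b c" by (rule prob_space_beta_dist) fact+
  have "(\<integral>\<^sup>+v. \<integral>\<^sup>+u. h (v * u) \<partial>beta_dist a b \<partial>beta_dist (a + b) c)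
      = (\<integral>\<^sup>+v. ?B (a + b) c v * (\<integral>\<^sup>+u. ?B a b u * h (v * u) \<partial>lborel) \<partial>lborel)"
    using sigma_finite_beta_dist[of a b]
    by (subst nn_integral_beta_dist; (subst nn_integral_beta_dist)?)
      (auto intro!: sigma_finite_measure.borel_measurable_nn_integral)
  also have "\<dots> = (\<integral>\<^sup>+v. \<integral>\<^sup>+z. ?B (a + b) c v * (ennreal (1 / v) * (?B a b (z / v) * h z)) \<partial>lborel \<partial>lborel)"
  proof (intro nn_integral_cong)
    fix v :: real
    show "?B (a + b) c v * (\<integral>\<^sup>+u. ?B a b u * h (v * u) \<partial>lborel)
      = (\<integral>\<^sup>+z. ?B (a + b) c v * (ennreal (1 / v) * (?B a b (z / v) * h z)) \<partial>lborel)"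
    proof (cases "v > 0")
      case True
      have "(\<integral>\<^sup>+u. ?B a b u * h (v * u) \<partial>lborel)
          = (\<integral>\<^sup>+z. ennreal \<bar>1 / v\<bar> * (?B a b (1 / v * z) * h (v * (1 / v * z))) \<partial>lborel)"
        using True by (intro nn_integral_lborel_scale) auto
      then show ?thesis
        using True by (subst nn_integral_cmult) auto
    next
      case False
      then have "?B (a + b) c v = 0"
        by (auto simp: beta_density_def not_less less_le split: split_indicator)
      then show ?thesis by simp
    qed
  qed
  also have "\<dots> = (\<integral>\<^sup>+z. \<integral>\<^sup>+v. ?B (a + b) c v * (ennreal (1 / v) * (?B a b (z / v) * h z)) \<partial>lborel \<partial>lborel)"
    by (intro lborel_pair.Fubini') auto
  also have "\<dots> = (\<integral>\<^sup>+z. ?B a (b + c) z * h z \<partial>lborel)"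
  proof (intro nn_integral_cong)
    fix z :: real
    show "(\<integral>\<^sup>+v. ?B (a + b) c v * (ennreal (1 / v) * (?B a b (z / v) * h z)) \<partial>lborel) = ?B a (b + c) z * h z"
    proof (cases "0 < z \<and> z < 1")
      case False
      have "?B (a + b) c v * (ennreal (1 / v) * (?B a b (z / v) * h z)) = 0" for v
      proof (cases "0 < v \<and> v < 1")
        case True
        then have "z / v \<le> 0 \<or> z / v \<ge> 1"
          using False by (auto simp: divide_simps not_less)
        then have "?B a b (z / v) = 0"
          by (auto simp: beta_density_def le_less split: split_indicator)
        then show ?thesis by simp
      next
        case False
        then have "?B (a + b) c v = 0"
          by (auto simp: beta_density_def not_less le_less split: split_indicator)
        then show ?thesis by simp
      qed
      moreover have "?B a (b + c) z = 0"
        using False by (auto simp: beta_density_def not_less le_less split: split_indicator)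
      ultimately show ?thesis
        by (subst nn_integral_cong[of lborel _ "\<lambda>_. 0"]) auto
    next
      case z: True
      \<comment> \<open>The substitution \<open>v = z + (1 - z) * w\<close> maps the unit interval
        onto the interval from \<open>z\<close> to 1, where both densities live. It turns
        \<open>1 - v\<close> into \<open>(1 - z) * (1 - w)\<close> and \<open>1 - z / v\<close> into
        \<open>(1 - z) * w / v\<close>, so all powers factor.\<close>
      have "(\<integral>\<^sup>+v. ?B (a + b) c v * (ennreal (1 / v) * (?B a b (z / v) * h z)) \<partial>lborel)
          = ennreal \<bar>1 - z\<bar> * (\<integral>\<^sup>+w. ?B (a + b) c (z + (1 - z) * w) *
             (ennreal (1 / (z + (1 - z) * w)) * (?B a b (z / (z + (1 - z) * w)) * h z)) \<partial>lborel)"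
        using z by (intro nn_integral_real_affine) auto
      also have "\<dots> = (\<integral>\<^sup>+w. ennreal (1 - z) * (?B (a + b) c (z + (1 - z) * w) *
             (ennreal (1 / (z + (1 - z) * w)) * (?B a b (z / (z + (1 - z) * w)) * h z))) \<partial>lborel)"
        using z by (subst nn_integral_cmult) auto
      also have "\<dots> = (\<integral>\<^sup>+w. ?B a (b + c) z * h z * ?B b c w \<partial>lborel)"
      proof (intro nn_integral_cong)
        fix w :: real
        define v where "v = z + (1 - z) * w"
        have "ennreal (1 - z) * (?B (a + b) c v * (ennreal (1 / v) * ?B a b (z / v))) = ?B a (b + c) z * ?B b c w"
        proof (cases "0 < w \<and> w < 1")
          case True
          have v: "z < v" "v < 1"
          proof -
            show "z < v" using z True by (simp add: v_def)
            have "(1 - z) * w < (1 - z) * 1" using z True by (intro mult_strict_left_mono) auto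
            then show "v < 1" by (simp add: v_def)
          qed
          have v0: "0 < v" using v z by simp
          have e1: "1 - v = (1 - z) * (1 - w)" by (simp add: v_def algebra_simps)
          have e2: "1 - z / v = (1 - z) * w / v" using v0 by (simp add: v_def field_simps)
          have P: "(1 - z) * (v powr (a + b - 1) * ((1 - z) * (1 - w)) powr (c - 1)) *
                (1 / v * ((z / v) powr (a - 1) * ((1 - z) * w / v) powr (b - 1)))
             = z powr (a - 1) * (1 - z) powr (b + c - 1) * (w powr (b - 1) * (1 - w) powr (c - 1))"
          proof -
            have "v powr (a + b - 1) = v * (v powr (a - 1) * v powr (b - 1))"
              using v0 by (simp add: powr_mult_base powr_add[symmetric] mult.assoc[symmetric])
            moreover have "(1 - z) powr (b + c - 1) = (1 - z) * ((1 - z) powr (b - 1) * (1 - z) powr (c - 1))"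
              using z by (simp add: powr_mult_base powr_add[symmetric] mult.assoc[symmetric])
            ultimately show ?thesis
              using v0 z True by (simp add: powr_mult powr_divide)
          qed
          have "ennreal (1 - z) * (?B (a + b) c v * (ennreal (1 / v) * ?B a b (z / v)))
             = ennreal ((1 - z) * ((Gamma (a + b + c) / (Gamma (a + b) * Gamma c)) * v powr (a + b - 1) * ((1 - z) * (1 - w)) powr (c - 1)
               * (1 / v * ((Gamma (a + b) / (Gamma a * Gamma b)) * (z / v) powr (a - 1) * ((1 - z) * w / v) powr (b - 1)))))"
            unfolding beta_density_def e1 e2 using v0 v z a b c True
            by (simp add: ennreal_mult[symmetric])
          also have "\<dots> = ennreal ((Gamma (a + b + c) / (Gamma (a + b) * Gamma c)) * (Gamma (a + b) / (Gamma a * Gamma b)) *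
              ((1 - z) * (v powr (a + b - 1) * ((1 - z) * (1 - w)) powr (c - 1)) *
                (1 / v * ((z / v) powr (a - 1) * ((1 - z) * w / v) powr (b - 1)))))"
            by (rule arg_cong[where f = ennreal]) (simp only: mult_ac)
          also have "\<dots> = ennreal ((Gamma (a + (b + c)) / (Gamma a * Gamma (b + c))) * z powr (a - 1) * (1 - z) powr (b + c - 1)
              * ((Gamma (b + c) / (Gamma b * Gamma c)) * w powr (b - 1) * (1 - w) powr (c - 1)))"
            unfolding P using a b c Gamma_real_pos[of "a + b", THEN less_imp_neq]
              Gamma_real_pos[of "b + c", THEN less_imp_neq]
            by (simp add: field_simps add.assoc)
          also have "\<dots> = ?B a (b + c) z * ?B b c w"
            unfolding beta_density_def using z a b c True
            by (simp add: ennreal_mult[symmetric])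
          finally show ?thesis .
        next
          case False
          have "?B b c w = 0"
            using False by (auto simp: beta_density_def not_less le_less split: split_indicator)
          moreover have "v \<le> z \<or> v \<ge> 1"
          proof (cases "w \<le> 0")
            case True
            then have "(1 - z) * w \<le> 0" using z by (simp add: mult_nonneg_nonpos)
            then show ?thesis by (simp add: v_def)
          next
            case w: False
            then have "(1 - z) * 1 \<le> (1 - z) * w" using z False by (intro mult_left_mono) auto
            then show ?thesis by (simp add: v_def)
          qed
          then have "?B (a + b) c v * ?B a b (z / v) = 0"
          proof (elim disjE)
            assume "v \<ge> 1"
            then show ?thesis by (auto simp: beta_density_def le_less split: split_indicator)
          next
            assume "v \<le> z"
            then have "v \<le> 0 \<or> z / v \<ge> 1" by (auto simp: divide_simps)
            then show ?thesis by (auto simp: beta_density_def le_less split: split_indicator)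
          qed
          ultimately show ?thesis by (auto simp: mult_ac)
        qed
        then show "ennreal (1 - z) * (?B (a + b) c (z + (1 - z) * w) *
             (ennreal (1 / (z + (1 - z) * w)) * (?B a b (z / (z + (1 - z) * w)) * h z)))
             = ?B a (b + c) z * h z * ?B b c w"
          unfolding v_def[symmetric] by (metis (no_types, lifting) mult.assoc mult.commute)
      qed
      also have "\<dots> = ?B a (b + c) z * h z * (\<integral>\<^sup>+w. 1 \<partial>beta_dist b c)"
        by (subst nn_integral_beta_dist) (auto simp: nn_integral_cmult)
      also have "\<dots> = ?B a (b + c) z * h z"
        using bc.emeasure_space_1 by simp
      finally show ?thesis .
    qed
  qed
  also have "\<dots> = (\<integral>\<^sup>+z. h z \<partial>beta_dist a (b + c))"
    by (subst nn_integral_beta_dist) auto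
  finally show ?thesis .
qed

section \<open>The square of a Gaussian variable\<close>

lemma prob_space_gauss_var: "s > 0 \<Longrightarrow> prob_space (gauss_var s)"
  unfolding gauss_var_def by (rule prob_space_normal_density) simp

lemma nn_integral_gauss_var:
  assumes [measurable]: "h \<in> borel_measurable borel"
  shows "(\<integral>\<^sup>+x. h x \<partial>gauss_var s) = (\<integral>\<^sup>+x. ennreal (normal_density 0 (sqrt s) x) * h x \<partial>lborel)"
  unfolding gauss_var_def by (subst nn_integral_density) auto

text \<open>Squaring is injective only on a half-line, and the substitution is made on compact
  intervals. The identity is therefore shown on \<open>{0..real n}\<close>, extended by continuity
  from below, and the resulting factor 2 is distributed over the two half-lines by symmetry of the
  normal density.\<close>

lemma nn_integral_gauss_var_square:
  fixes h :: "real \<Rightarrow> ennreal"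
  assumes s: "s > 0" and [measurable]: "h \<in> borel_measurable borel"
  shows "(\<integral>\<^sup>+x. h (x\<^sup>2) \<partial>gauss_var s) = (\<integral>\<^sup>+y. h y \<partial>gamma_dist s (1 / 2))"
proof -
  let ?n = "normal_density 0 (sqrt s)" and ?g = "gamma_density s (1 / 2)"
  let ?f = "\<lambda>x. ennreal (?n x) * h (x\<^sup>2)"
  \<comment> \<open>The factor \<open>2 * x\<close> on the right is the derivative of the square;
    the 2 on the left counts the square roots \<open>x\<close> and \<open>- x\<close>.\<close>
  have pos: "ennreal (2 * ?n x) = ?g (x\<^sup>2) * ennreal (2 * x)" if "x > 0" for x
  proof -
    have "(x\<^sup>2) powr (1 / 2 - 1) = 1 / x"
      using that by (simp add: powr_powr powr_numeral[symmetric] powr_minus_divide del: powr_numeral)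
    moreover have "(2 * s) powr (1 / 2) * sqrt pi = sqrt (2 * pi * s)"
      using s by (simp add: powr_half_sqrt real_sqrt_mult)
    ultimately show ?thesis
      using that s
      by (simp add: gamma_density_def normal_density_def ennreal_mult[symmetric] Gamma_one_half_real field_simps)
  qed
  have part: "(\<integral>\<^sup>+y. ?g y * h y * indicator {0..(real n)\<^sup>2} y \<partial>lborel)
      = (\<integral>\<^sup>+x. 2 * (?f x * indicator {0<..real n} x) \<partial>lborel)" for n :: nat
  proof (cases "n = 0")
    case True
    then show ?thesis
      by (auto simp: gamma_density_def split: split_indicator intro!: nn_integral_cong)
  next
    case False
    have "(\<integral>\<^sup>+y. ?g y * h y * indicator {0\<^sup>2..(real n)\<^sup>2} y \<partial>lborel)
        = (\<integral>\<^sup>+x. ?g (x\<^sup>2) * h (x\<^sup>2) * ennreal (2 * x) * indicator {0..real n} x \<partial>lborel)"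
      using False
      by (intro nn_integral_substitution_aux) (auto intro!: derivative_eq_intros continuous_intros)
    also have "\<dots> = (\<integral>\<^sup>+x. 2 * (?f x * indicator {0<..real n} x) \<partial>lborel)"
    proof (intro nn_integral_cong)
      fix x
      have "ennreal (2 * ?n x) = 2 * ennreal (?n x)"
        by (subst ennreal_mult) auto
      then show "?g (x\<^sup>2) * h (x\<^sup>2) * ennreal (2 * x) * indicator {0..real n} x
        = 2 * (?f x * indicator {0<..real n} x)"
        using pos[of x] by (auto split: split_indicator simp flip: mult.assoc) (simp add: mult_ac)
    qed
    finally show ?thesis by simp
  qed
  have union: "(\<Union>n. {0..(real n)\<^sup>2}) = {0..}" "(\<Union>n. {0<..real n}) = {0<..}"
  proof -
    have ex: "\<exists>n. y \<le> (real n)\<^sup>2 \<and> y \<le> real n" for y :: real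
    proof -
      obtain n where "real n > max y 1" using reals_Archimedean2 by blast
      then have "y \<le> real n" "real n * 1 \<le> real n * real n" by (auto intro!: mult_left_mono)
      then show ?thesis by (auto intro!: exI[of _ n] simp: power2_eq_square)
    qed
    have ex1: "\<exists>n. y \<le> (real n)\<^sup>2" and ex2: "\<exists>n. y \<le> real n" for y :: real
      using ex[of y] by blast+
    show "(\<Union>n. {0..(real n)\<^sup>2}) = {0..}" "(\<Union>n. {0<..real n}) = {0<..}"
      by (simp_all add: set_eq_iff ex1 ex2)
  qed
  let ?G = "density lborel (\<lambda>y. ?g y * h y)" and ?F = "density lborel (\<lambda>x. 2 * ?f x)"
  have "(\<integral>\<^sup>+y. h y \<partial>gamma_dist s (1 / 2)) = (\<integral>\<^sup>+y. ?g y * h y * indicator {0..} y \<partial>lborel)"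
    by (subst nn_integral_gamma_dist)
      (auto intro!: nn_integral_cong simp: gamma_density_def split: split_indicator)
  also have "\<dots> = emeasure ?G (\<Union>n. {0..(real n)\<^sup>2})"
    unfolding union by (subst emeasure_density) auto
  also have "\<dots> = (SUP n. emeasure ?G {0..(real n)\<^sup>2})"
    by (intro SUP_emeasure_incseq[symmetric])
      (auto simp: incseq_def elim!: order_trans intro!: power_mono)
  also have "\<dots> = (SUP n. emeasure ?F {0<..real n})"
    using part by (simp add: emeasure_density mult.assoc)
  also have "\<dots> = emeasure ?F (\<Union>n. {0<..real n})"
    by (intro SUP_emeasure_incseq) (auto simp: incseq_def)
  also have "\<dots> = 2 * (\<integral>\<^sup>+x. ?f x * indicator {0<..} x \<partial>lborel)"
    unfolding union by (subst emeasure_density) (auto simp: nn_integral_cmult mult.assoc)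
  also have "\<dots> = (\<integral>\<^sup>+x. ?f x * indicator {0<..} x \<partial>lborel) + (\<integral>\<^sup>+x. ?f x * indicator {..<0} x \<partial>lborel)"
  proof -
    have "(\<integral>\<^sup>+x. ?f x * indicator {0<..} x \<partial>lborel) = (\<integral>\<^sup>+x. ?f x * indicator {..<0} x \<partial>lborel)"
      by (subst nn_integral_lborel_scale[where c = "-1"])
        (auto intro!: nn_integral_cong simp: normal_density_def split: split_indicator)
    then show ?thesis by (simp add: mult_2)
  qed
  also have "\<dots> = (\<integral>\<^sup>+x. ?f x * indicator {0<..} x + ?f x * indicator {..<0} x \<partial>lborel)"
    by (intro nn_integral_add[symmetric]) auto
  also have "\<dots> = (\<integral>\<^sup>+x. ?f x \<partial>lborel)"
    using AE_lborel_singleton[of 0]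
    by (intro nn_integral_cong_AE, eventually_elim) (auto split: split_indicator)
  also have "\<dots> = (\<integral>\<^sup>+x. h (x\<^sup>2) \<partial>gauss_var s)"
    by (subst nn_integral_gauss_var) auto
  finally show ?thesis by simp
qed

subsection \<open>Squared norms of Gaussian vectors\<close>

locale gaussian =
  fixes s :: real
  assumes s_pos: "s > 0"
begin

abbreviation gauss :: "'i set \<Rightarrow> ('i \<Rightarrow> real) measure" where
  "gauss I \<equiv> PiM I (\<lambda>_. gauss_var s)"

sublocale gv: prob_space "gauss_var s"
  using s_pos by (rule prob_space_gauss_var)

sublocale gvp: product_prob_space "\<lambda>_. gauss_var s" I for I :: "'i set"
  by unfold_locales

text \<open>Additivity of the shape is \<open>nn_integral_gamma_gamma\<close> for a function of the
  sum alone. The induction starts at singletons because there is no gamma density of shape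
  0.\<close>

lemma gauss_sum_squares:
  assumes "finite I" "I \<noteq> {}" and [measurable]: "h \<in> borel_measurable borel"
  shows "(\<integral>\<^sup>+x. h (\<Sum>i\<in>I. (x i)\<^sup>2) \<partial>gauss I) = (\<integral>\<^sup>+r. h r \<partial>gamma_dist s (card I / 2))"
  using assms
proof (induction I arbitrary: h rule: finite_ne_induct)
  case (singleton i)
  then have [measurable]: "h \<in> borel_measurable borel" by simp
  have "(\<integral>\<^sup>+x. h (\<Sum>i\<in>{i}. (x i)\<^sup>2) \<partial>gauss {i}) = (\<integral>\<^sup>+x. h (x\<^sup>2) \<partial>gauss_var s)"
    by (subst gvp.product_nn_integral_singleton[symmetric]) auto
  then show ?case
    using nn_integral_gauss_var_square[OF s_pos, of h] by simp
next
  case (insert i I)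
  then have [measurable]: "h \<in> borel_measurable borel" by simp
  let ?k = "card I / 2"
  have k: "?k > 0" using insert by (simp add: card_gt_0_iff)
  interpret Ga: prob_space "gamma_dist s ?k" using k s_pos by (rule prob_space_gamma_dist)
  interpret Gh: prob_space "gamma_dist s (1/2)" by (rule prob_space_gamma_dist) (use s_pos in auto)
  interpret B: prob_space "beta_dist (1 / 2) ?k" by (rule prob_space_beta_dist) (use k in auto)
  have "(\<integral>\<^sup>+x. h (\<Sum>j\<in>insert i I. (x j)\<^sup>2) \<partial>gauss (insert i I))
      = (\<integral>\<^sup>+y. \<integral>\<^sup>+x. h (\<Sum>j\<in>insert i I. ((x(i := y)) j)\<^sup>2 :: real) \<partial>gauss I \<partial>gauss_var s)"
    using insert by (intro gvp.product_nn_integral_insert_rev) auto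
  also have "\<dots> = (\<integral>\<^sup>+y. \<integral>\<^sup>+x. h (y\<^sup>2 + (\<Sum>j\<in>I. (x j)\<^sup>2)) \<partial>gauss I \<partial>gauss_var s)"
  proof (intro nn_integral_cong)
    fix y and x :: "'a \<Rightarrow> real"
    have "(\<Sum>j\<in>I. ((x(i := y)) j)\<^sup>2) = (\<Sum>j\<in>I. (x j)\<^sup>2)"
      using insert by (intro sum.cong) auto
    then show "h (\<Sum>j\<in>insert i I. ((x(i := y)) j)\<^sup>2) = h (y\<^sup>2 + (\<Sum>j\<in>I. (x j)\<^sup>2))"
      using insert by simp
  qed
  also have "\<dots> = (\<integral>\<^sup>+y. \<integral>\<^sup>+r. h (y\<^sup>2 + r) \<partial>gamma_dist s ?k \<partial>gauss_var s)"
    by (intro nn_integral_cong insert.IH) auto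
  also have "\<dots> = (\<integral>\<^sup>+y. \<integral>\<^sup>+r. h (y + r) \<partial>gamma_dist s ?k \<partial>gamma_dist s (1 / 2))"
    by (intro nn_integral_gauss_var_square[OF s_pos, of "\<lambda>y. \<integral>\<^sup>+r. h (y + r) \<partial>gamma_dist s ?k"]) auto
  also have "\<dots> = (\<integral>\<^sup>+r. \<integral>\<^sup>+u. h r \<partial>beta_dist (1 / 2) ?k \<partial>gamma_dist s (1 / 2 + ?k))"
    using k s_pos by (intro nn_integral_gamma_gamma) auto
  also have "\<dots> = (\<integral>\<^sup>+r. h r \<partial>gamma_dist s (card (insert i I) / 2))"
    using insert B.emeasure_space_1 by (simp add: add_divide_distrib)
  finally show ?case .
qed

lemma nn_integral_chi2:
  assumes [measurable]: "h \<in> borel_measurable borel"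
  shows "(\<integral>\<^sup>+r. h r \<partial>chi2 n s) = (\<integral>\<^sup>+x. h (\<Sum>i<n. (x i)\<^sup>2) \<partial>gauss {..<n})"
  unfolding chi2_def by (subst nn_integral_distr) auto

lemma nn_integral_chi2_gamma:
  assumes "n > 0" and [measurable]: "h \<in> borel_measurable borel"
  shows "(\<integral>\<^sup>+r. h r \<partial>chi2 n s) = (\<integral>\<^sup>+r. h r \<partial>gamma_dist s (n / 2))"
  using assms by (simp add: nn_integral_chi2 gauss_sum_squares lessThan_empty_iff)

lemma prob_space_chi2: "prob_space (chi2 n s)"
  unfolding chi2_def by (intro prob_space.prob_space_distr prob_space_PiM gv.prob_space_axioms) measurable

lemma gauss_sum_squares_chi2:
  assumes "finite I" "I \<noteq> {}" and [measurable]: "h \<in> borel_measurable borel"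
  shows "(\<integral>\<^sup>+x. h (\<Sum>i\<in>I. (x i)\<^sup>2) \<partial>gauss I) = (\<integral>\<^sup>+r. h r \<partial>chi2 (card I) s)"
  using assms by (simp add: gauss_sum_squares nn_integral_chi2_gamma card_gt_0_iff)

text \<open>The squares other than that of \<open>x i\<close> sum to a gamma variable of shape
  \<open>(card I - 1) / 2\<close>, independent of \<open>(x i)\<^sup>2\<close>, which has shape
  \<open>1 / 2\<close>. The share of the former in the total is the squared sine of the angle with
  axis \<open>i\<close>, the factor by which the squared corner entry shrinks later.\<close>

lemma gauss_norm_angle:
  fixes h :: "real \<Rightarrow> real \<Rightarrow> ennreal"
  assumes I: "finite I" "i \<in> I" "card I \<ge> 2"
    and [measurable]: "(\<lambda>(r, u). h r u) \<in> borel_measurable (borel \<Otimes>\<^sub>M borel)"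
  shows "(\<integral>\<^sup>+x. h (\<Sum>j\<in>I. (x j)\<^sup>2) ((\<Sum>j\<in>I - {i}. (x j)\<^sup>2) / (\<Sum>j\<in>I. (x j)\<^sup>2)) \<partial>gauss I)
       = (\<integral>\<^sup>+r. \<integral>\<^sup>+u. h r u \<partial>beta_dist ((real (card I) - 1) / 2) (1 / 2) \<partial>chi2 (card I) s)"
proof -
  define J where "J = I - {i}"
  define k where "k = card J / 2"
  have cJ: "card J = card I - 1" using I by (simp add: J_def)
  have "J \<noteq> {}" using cJ I by force
  then have J: "finite J" "i \<notin> J" "insert i J = I" "J \<noteq> {}" "card J = card I - 1"
    using I cJ by (auto simp: J_def)
  have k: "k > 0" "k = (real (card I) - 1) / 2"
    using J I by (auto simp: k_def card_gt_0_iff of_nat_diff)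
  interpret Ga: prob_space "gamma_dist s k" using k(1) s_pos by (rule prob_space_gamma_dist)
  interpret Gh: prob_space "gamma_dist s (1/2)" by (rule prob_space_gamma_dist) (use s_pos in auto)
  interpret B: prob_space "beta_dist k (1 / 2)" by (rule prob_space_beta_dist) (use k in auto)
  let ?S = "\<lambda>x. \<Sum>j\<in>J. (x j :: real)\<^sup>2"
  have "(\<integral>\<^sup>+x. h (\<Sum>j\<in>I. (x j)\<^sup>2) ((\<Sum>j\<in>I - {i}. (x j)\<^sup>2) / (\<Sum>j\<in>I. (x j)\<^sup>2)) \<partial>gauss I)
      = (\<integral>\<^sup>+x. h (?S x + (x i)\<^sup>2) (?S x / (?S x + (x i)\<^sup>2)) \<partial>gauss (insert i J))"
    using J unfolding J_def[symmetric] J(3)[symmetric] by (simp add: add.commute)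
  also have "\<dots> = (\<integral>\<^sup>+x. \<integral>\<^sup>+y. h (?S (x(i := y)) + ((x(i := y)) i)\<^sup>2)
        (?S (x(i := y)) / (?S (x(i := y)) + ((x(i := y)) i)\<^sup>2)) \<partial>gauss_var s \<partial>gauss J)"
    using J by (intro gvp.product_nn_integral_insert) auto
  also have "\<dots> = (\<integral>\<^sup>+x. \<integral>\<^sup>+y. h (?S x + y\<^sup>2) (?S x / (?S x + y\<^sup>2)) \<partial>gauss_var s \<partial>gauss J)"
  proof -
    have "?S (x(i := y)) = ?S x" for x y
      using J by (intro sum.cong) auto
    then show ?thesis by simp
  qed
  also have "\<dots> = (\<integral>\<^sup>+x. \<integral>\<^sup>+y. h (?S x + y) (?S x / (?S x + y)) \<partial>gamma_dist s (1 / 2) \<partial>gauss J)"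
    by (intro nn_integral_cong nn_integral_gauss_var_square s_pos) auto
  also have "\<dots> = (\<integral>\<^sup>+x. \<integral>\<^sup>+y. h (x + y) (x / (x + y)) \<partial>gamma_dist s (1 / 2) \<partial>gamma_dist s k)"
    unfolding k_def
    by (intro gauss_sum_squares[of J "\<lambda>x. \<integral>\<^sup>+y. h (x + y) (x / (x + y)) \<partial>gamma_dist s (1 / 2)"] J) auto
  also have "\<dots> = (\<integral>\<^sup>+r. \<integral>\<^sup>+u. h r u \<partial>beta_dist k (1 / 2) \<partial>gamma_dist s (k + 1 / 2))"
    using k s_pos by (intro nn_integral_gamma_gamma) auto
  also have "k + 1 / 2 = card I / 2" unfolding k(2) by (simp add: field_simps)
  also have "(\<integral>\<^sup>+r. \<integral>\<^sup>+u. h r u \<partial>beta_dist k (1 / 2) \<partial>gamma_dist s (card I / 2))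
      = (\<integral>\<^sup>+r. \<integral>\<^sup>+u. h r u \<partial>beta_dist k (1 / 2) \<partial>chi2 (card I) s)"
    using I by (intro nn_integral_chi2_gamma[symmetric]) auto
  finally show ?thesis unfolding k(2) .
qed

end

subsection \<open>Plane rotations\<close>

text \<open>The index type is left free because the same rotation acts on a single row, indexed by
  numbers, and on two entries of the whole Gaussian array, indexed by pairs.\<close>

definition rot2 :: "real \<Rightarrow> real \<Rightarrow> 'i \<Rightarrow> 'i \<Rightarrow> ('i \<Rightarrow> real) \<Rightarrow> 'i \<Rightarrow> real" where
  "rot2 c d p q v = v(p := c * v p - d * v q, q := d * v p + c * v q)"

text \<open>Generated by plane rotations instead of described by orthogonal matrices: linearity,
  preservation of inner products and invariance of the Gaussian measure each follow by induction
  from the case of one rotation.\<close>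

inductive rot :: "nat \<Rightarrow> ((nat \<Rightarrow> real) \<Rightarrow> nat \<Rightarrow> real) \<Rightarrow> bool" for n where
  rot_id: "rot n (\<lambda>v. v)"
| rot_step: "rot n T \<Longrightarrow> p < n \<Longrightarrow> q < n \<Longrightarrow> p \<noteq> q \<Longrightarrow> c\<^sup>2 + d\<^sup>2 = 1 \<Longrightarrow> rot n (\<lambda>v. rot2 c d p q (T v))"

lemma rot_comp: "rot n S \<Longrightarrow> rot n T \<Longrightarrow> rot n (\<lambda>v. S (T v))"
  by (induction rule: rot.induct) (auto intro: rot.intros)

lemma sum_split_two:
  fixes f :: "'i \<Rightarrow> 'b::comm_monoid_add"
  assumes "finite A" "p \<in> A" "q \<in> A" "p \<noteq> q"
  shows "sum f A = f p + (f q + sum f (A - {p} - {q}))"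
proof -
  have "sum f A = f p + sum f (A - {p})" using assms by (intro sum.remove) auto
  also have "sum f (A - {p}) = f q + sum f (A - {p} - {q})" using assms by (intro sum.remove) auto
  finally show ?thesis .
qed

lemma rot2_inner:
  assumes "finite A" "p \<in> A" "q \<in> A" "p \<noteq> q" "c\<^sup>2 + d\<^sup>2 = 1"
  shows "(\<Sum>k\<in>A. rot2 c d p q u k * rot2 c d p q v k) = (\<Sum>k\<in>A. u k * v k)"
proof -
  have "(c * u p - d * u q) * (c * v p - d * v q) + (d * u p + c * u q) * (d * v p + c * v q)
      = (c\<^sup>2 + d\<^sup>2) * (u p * v p + u q * v q)"
    by (simp add: power2_eq_square algebra_simps)
  then have "(c * u p - d * u q) * (c * v p - d * v q) + (d * u p + c * u q) * (d * v p + c * v q)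
      = u p * v p + u q * v q"
    using assms by simp
  moreover have "(\<Sum>k\<in>A - {p} - {q}. rot2 c d p q u k * rot2 c d p q v k) = (\<Sum>k\<in>A - {p} - {q}. u k * v k)"
    by (intro sum.cong) (auto simp: rot2_def)
  ultimately show ?thesis
    using assms by (simp add: sum_split_two[OF assms(1-4)]) (simp add: rot2_def)
qed

lemma rot_inner: "rot n T \<Longrightarrow> (\<Sum>k<n. T u k * T v k) = (\<Sum>k<n. u k * v k)"
  by (induction rule: rot.induct) (simp_all add: rot2_inner)

text \<open>Linearity in coordinates. It lets \<open>T\<close> act on complex entries and appear as
  a matrix factor in \<open>gdet_col_map\<close>.\<close>

lemma rot_matrix: "rot n T \<Longrightarrow> \<exists>R. \<forall>v. \<forall>i<n. T v i = (\<Sum>k<n. R i k * v k)"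
proof (induction rule: rot.induct)
  case rot_id
  have "v i = (\<Sum>k<n. of_bool (i = k) * v k)" if "i < n" for v :: "nat \<Rightarrow> real" and i
    using that by (simp add: sum.If_cases of_bool_def if_distrib[of "\<lambda>x. x * _"] cong: if_cong)
  then show ?case by (intro exI[of _ "\<lambda>i k. of_bool (i = k)"]) blast
next
  case (rot_step T p q c d)
  then obtain R where R: "T v i = (\<Sum>k<n. R i k * v k)" if "i < n" for v i by blast
  define R' where "R' i k = rot2 c d p q (\<lambda>i. R i k) i" for i k
  have "rot2 c d p q (T v) i = (\<Sum>k<n. R' i k * v k)" if "i < n" for v i
    using that rot_step.hyps
    by (simp add: R'_def rot2_def R sum_distrib_left sum_subtractf sum.distrib algebra_simps)
  then show ?case by blast
qed

text \<open>Givens elimination: the entries in \<open>S\<close> are rotated one after another into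
  position \<open>p\<close>. The map depends on \<open>v\<close>, but the last two clauses speak of
  every \<open>w\<close>; they tell what the same map does to a second vector, which is how the
  corner entry is followed in \<open>rot_align\<close>.\<close>

lemma rot_reduce:
  assumes "finite S" "S \<subseteq> {..<n}" "p < n" "p \<notin> S"
  shows "\<exists>T. rot n T \<and> (\<forall>k\<in>S. T v k = 0) \<and> (T v p)\<^sup>2 = (v p)\<^sup>2 + (\<Sum>k\<in>S. (v k)\<^sup>2) \<and>
    (\<forall>w k. k \<notin> insert p S \<longrightarrow> T w k = w k) \<and> (\<forall>w. (\<forall>k\<in>insert p S. w k = 0) \<longrightarrow> T w = w)"
  using assms
proof (induction S rule: finite_induct)
  case empty
  show ?case by (rule exI[of _ "\<lambda>v. v"]) (auto intro: rot_id)
next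
  case (insert j S)
  then obtain T where T: "rot n T" "\<And>k. k \<in> S \<Longrightarrow> T v k = 0" "(T v p)\<^sup>2 = (v p)\<^sup>2 + (\<Sum>k\<in>S. (v k)\<^sup>2)"
    "\<And>w k. k \<notin> insert p S \<Longrightarrow> T w k = w k" "\<And>w. (\<forall>k\<in>insert p S. w k = 0) \<Longrightarrow> T w = w"
    by auto
  have vj: "T v j = v j" using insert by (intro T) auto
  define r where "r = sqrt ((T v p)\<^sup>2 + (v j)\<^sup>2)"
  have r2: "r\<^sup>2 = (T v p)\<^sup>2 + (v j)\<^sup>2" by (simp add: r_def)
  show ?case
  proof (cases "r = 0")
    case True
    then have "v j = 0" "T v p = 0" using r2 by (auto simp: sum_power2_eq_zero_iff)
    then show ?thesis
      using insert T vj by (intro exI[of _ T]) auto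
  next
    case False
    \<comment> \<open>Cosine and sine of the rotation that takes the pair
      \<open>(T v p, v j)\<close> to \<open>(r, 0)\<close>.\<close>
    define c where "c = T v p / r"
    define d where "d = - (v j / r)"
    have cd: "c\<^sup>2 + d\<^sup>2 = 1"
    proof -
      have "c\<^sup>2 + d\<^sup>2 = ((T v p)\<^sup>2 + (v j)\<^sup>2) / r\<^sup>2"
        by (simp add: c_def d_def power_divide add_divide_distrib)
      then show ?thesis using False unfolding r2[symmetric] by simp
    qed
    have "c * T v p - d * T v j = r"
    proof -
      have "c * T v p - d * T v j = r\<^sup>2 / r"
        unfolding r2 by (simp add: c_def d_def vj power2_eq_square add_divide_distrib)
      then show ?thesis using False by (simp add: power2_eq_square)
    qed
    moreover have "d * T v p + c * T v j = 0"
      by (simp add: c_def d_def vj)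
    ultimately have new: "rot2 c d p j (T v) = (T v)(p := r, j := 0)"
      by (simp add: rot2_def)
    have "rot n (\<lambda>v. rot2 c d p j (T v))"
      using insert T(1) cd by (intro rot_step) auto
    moreover have "rot2 c d p j w = w" if "\<forall>k\<in>insert p (insert j S). w k = 0" for w
      using that by (auto simp: rot2_def)
    moreover have "rot2 c d p j (T w) k = w k" if "k \<notin> insert p (insert j S)" for w k
      using that T(4)[of k w] by (auto simp: rot2_def)
    ultimately show ?thesis
      using insert T(2,3,5) r2 by (intro exI[of _ "\<lambda>v. rot2 c d p j (T v)"]) (auto simp: new)
  qed
qed

lemma rot_reduceE:
  assumes "finite S" "S \<subseteq> {..<n}" "p < n" "p \<notin> S"
  obtains T where "rot n T" "\<And>k. k \<in> S \<Longrightarrow> T v k = 0" "(T v p)\<^sup>2 = (v p)\<^sup>2 + (\<Sum>k\<in>S. (v k)\<^sup>2)"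
    "\<And>w k. k \<notin> insert p S \<Longrightarrow> T w k = w k" "\<And>w. (\<And>k. k \<in> insert p S \<Longrightarrow> w k = 0) \<Longrightarrow> T w = w"
proof -
  obtain T where T: "rot n T" "\<forall>k\<in>S. T v k = 0" "(T v p)\<^sup>2 = (v p)\<^sup>2 + (\<Sum>k\<in>S. (v k)\<^sup>2)"
    "\<forall>w k. k \<notin> insert p S \<longrightarrow> T w k = w k" "\<forall>w. (\<forall>k\<in>insert p S. w k = 0) \<longrightarrow> T w = w"
    using rot_reduce[OF assms, of v] by (elim exE conjE)
  show ?thesis
    by (rule that[OF T(1) _ T(3)]) (use T(2,4,5) in \<open>simp_all\<close>)
qed

section \<open>Rotation invariance of the Gaussian measure\<close>

text \<open>For \<open>c \<noteq> 0\<close> the rotation splits into two affine substitutions in one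
  variable: \<open>u = c * x - d * y\<close> for fixed \<open>y\<close>, then
  \<open>v = d / c * u + 1 / c * y\<close> for fixed \<open>u\<close>. Their Jacobians
  \<open>\<bar>c\<bar>\<close> and \<open>1 / \<bar>c\<bar>\<close> cancel. For \<open>c = 0\<close>
  the map is a quarter turn, an exchange of the variables and a sign.\<close>

lemma nn_integral_lborel_rotate:
  fixes F :: "real \<Rightarrow> real \<Rightarrow> ennreal"
  assumes [measurable]: "(\<lambda>(x, y). F x y) \<in> borel_measurable (borel \<Otimes>\<^sub>M borel)"
    and cd: "c\<^sup>2 + d\<^sup>2 = 1"
  shows "(\<integral>\<^sup>+x. \<integral>\<^sup>+y. F (c * x - d * y) (d * x + c * y) \<partial>lborel \<partial>lborel) = (\<integral>\<^sup>+x. \<integral>\<^sup>+y. F x y \<partial>lborel \<partial>lborel)"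
proof (cases "c = 0")
  case True
  then have d: "d \<noteq> 0" "\<bar>d\<bar> = 1" using cd by (auto simp: power2_eq_1_iff)
  have "(\<integral>\<^sup>+x. \<integral>\<^sup>+y. F x y \<partial>lborel \<partial>lborel) = (\<integral>\<^sup>+y. \<integral>\<^sup>+x. F x y \<partial>lborel \<partial>lborel)"
    by (intro lborel_pair.Fubini') auto
  also have "\<dots> = (\<integral>\<^sup>+x. \<integral>\<^sup>+v. F v (d * x) \<partial>lborel \<partial>lborel)"
    using d by (subst nn_integral_lborel_scale[where c = d]) auto
  also have "\<dots> = (\<integral>\<^sup>+x. \<integral>\<^sup>+y. F (- d * y) (d * x) \<partial>lborel \<partial>lborel)"
    by (rule nn_integral_cong, subst nn_integral_lborel_scale[where c = "- d"]) (use d in auto)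
  finally show ?thesis using True by simp
next
  case False
  have e: "d * d / c + c = 1 / c" using cd False by (simp add: field_simps power2_eq_square)
  have 1: "(\<integral>\<^sup>+x. F (c * x - d * y) (d * x + c * y) \<partial>lborel)
      = (\<integral>\<^sup>+u. ennreal (1 / \<bar>c\<bar>) * F u (d / c * u + 1 / c * y) \<partial>lborel)" for y
  proof -
    let ?f = "\<lambda>u. F u (d / c * u + 1 / c * y)"
    have "?f (- (d * y) + c * x) = F (c * x - d * y) (d * x + c * y)" for x
    proof -
      have "d / c * (- (d * y) + c * x) + 1 / c * y = d * x + (1 / c - d * d / c) * y"
        using False by (simp add: field_simps)
      also have "1 / c - d * d / c = c" using e by simp
      finally show ?thesis by simp
    qed
    moreover have "(\<integral>\<^sup>+u. ?f u \<partial>lborel) = \<bar>c\<bar> * (\<integral>\<^sup>+x. ?f (- (d * y) + c * x) \<partial>lborel)"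
      using False by (intro nn_integral_real_affine) auto
    ultimately show ?thesis
      using False by (simp add: nn_integral_cmult mult.assoc[symmetric] ennreal_mult[symmetric])
  qed
  have 2: "(\<integral>\<^sup>+v. F u v \<partial>lborel) = (\<integral>\<^sup>+y. ennreal (1 / \<bar>c\<bar>) * F u (d / c * u + 1 / c * y) \<partial>lborel)" for u
    using False nn_integral_real_affine[of "F u" "1 / c" "d / c * u"] by (simp add: nn_integral_cmult)
  have "(\<integral>\<^sup>+x. \<integral>\<^sup>+y. F (c * x - d * y) (d * x + c * y) \<partial>lborel \<partial>lborel)
      = (\<integral>\<^sup>+y. \<integral>\<^sup>+x. F (c * x - d * y) (d * x + c * y) \<partial>lborel \<partial>lborel)"
    by (intro lborel_pair.Fubini') auto
  also have "\<dots> = (\<integral>\<^sup>+u. \<integral>\<^sup>+y. ennreal (1 / \<bar>c\<bar>) * F u (d / c * u + 1 / c * y) \<partial>lborel \<partial>lborel)"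
    unfolding 1 by (intro lborel_pair.Fubini') auto
  finally show ?thesis unfolding 2 .
qed

text \<open>The joint density of two independent copies depends on
  \<open>x\<^sup>2 + y\<^sup>2\<close> only.\<close>

lemma nn_integral_gauss_var_rotate:
  fixes h :: "real \<Rightarrow> real \<Rightarrow> ennreal"
  assumes "s > 0" and [measurable]: "(\<lambda>(x, y). h x y) \<in> borel_measurable (borel \<Otimes>\<^sub>M borel)"
    and cd: "c\<^sup>2 + d\<^sup>2 = 1"
  shows "(\<integral>\<^sup>+x. \<integral>\<^sup>+y. h (c * x - d * y) (d * x + c * y) \<partial>gauss_var s \<partial>gauss_var s)
       = (\<integral>\<^sup>+x. \<integral>\<^sup>+y. h x y \<partial>gauss_var s \<partial>gauss_var s)"
proof -
  interpret prob_space "gauss_var s" by (rule prob_space_gauss_var) fact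
  let ?p = "normal_density 0 (sqrt s)"
  have ex: "(\<integral>\<^sup>+x. \<integral>\<^sup>+y. g x y \<partial>gauss_var s \<partial>gauss_var s) = (\<integral>\<^sup>+x. \<integral>\<^sup>+y. ennreal (?p x * ?p y) * g x y \<partial>lborel \<partial>lborel)"
    if [measurable]: "(\<lambda>(x, y). g x y) \<in> borel_measurable (borel \<Otimes>\<^sub>M borel)" for g
    by (simp add: nn_integral_gauss_var nn_integral_cmult[symmetric] ennreal_mult mult.assoc)
  have "?p (c * x - d * y) * ?p (d * x + c * y) = ?p x * ?p y" for x y
  proof -
    have "(c * x - d * y)\<^sup>2 + (d * x + c * y)\<^sup>2 = (c\<^sup>2 + d\<^sup>2) * (x\<^sup>2 + y\<^sup>2)"
      by (simp add: power2_eq_square algebra_simps)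
    moreover have "- X / (2 * s) + - Y / (2 * s) = - (X + Y) / (2 * s)" for X Y :: real
      by (simp add: diff_divide_distrib)
    ultimately have "- (c * x - d * y)\<^sup>2 / (2 * s) + - (d * x + c * y)\<^sup>2 / (2 * s) = - x\<^sup>2 / (2 * s) + - y\<^sup>2 / (2 * s)"
      using cd by simp
    then have "exp (- (c * x - d * y)\<^sup>2 / (2 * s)) * exp (- (d * x + c * y)\<^sup>2 / (2 * s))
        = exp (- x\<^sup>2 / (2 * s)) * exp (- y\<^sup>2 / (2 * s))"
      by (simp only: exp_add[symmetric])
    then show ?thesis
      using \<open>s > 0\<close> by (simp add: normal_density_def)
  qed
  then show ?thesis
    using nn_integral_lborel_rotate[of "\<lambda>x y. ennreal (?p x * ?p y) * h x y", OF _ cd]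
    by (simp add: ex)
qed

definition grid :: "nat \<Rightarrow> nat \<Rightarrow> (nat \<times> nat) set" where
  "grid m n = {..<m} \<times> {..<n}"

lemma finite_grid [simp]: "finite (grid m n)"
  by (simp add: grid_def)

lemma mem_grid [simp]: "(i, k) \<in> grid m n \<longleftrightarrow> i < m \<and> k < n"
  by (simp add: grid_def)

text \<open>On the matrix this is multiplication from the right, since \<open>T\<close> mixes
  entries within each row. Multiplication from the left is obtained by conjugating it with
  \<open>prod.swap\<close>.\<close>

definition row_map :: "nat \<Rightarrow> ((nat \<Rightarrow> real) \<Rightarrow> nat \<Rightarrow> real) \<Rightarrow> (nat \<times> nat \<Rightarrow> real) \<Rightarrow> nat \<times> nat \<Rightarrow> real" where
  "row_map m T x = (\<lambda>(i, k). if i < m then T (\<lambda>k. x (i, k)) k else x (i, k))"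

context gaussian
begin

lemma measurable_coord: "p \<in> I \<Longrightarrow> (\<lambda>x. x p) \<in> borel_measurable (gauss I)"
  by (subst measurable_cong_sets[OF refl sets_gauss_var[of s, symmetric]]) (rule measurable_component_singleton)

lemma measurable_rot2:
  assumes [simp]: "p \<in> I" "q \<in> I"
  shows "rot2 c d p q \<in> measurable (gauss I) (gauss I)"
proof -
  have "rot2 c d p q = (\<lambda>v. v(p := c * v p - d * v q, q := d * v p + c * v q))"
    by (simp add: rot2_def fun_eq_iff)
  also have "\<dots> \<in> measurable (gauss I) (gauss I)"
  proof (rule measurable_PiM_single')
    fix i assume i: "i \<in> I"
    show "(\<lambda>v. (v(p := c * v p - d * v q, q := d * v p + c * v q)) i) \<in> measurable (gauss I) (gauss_var s)"
      unfolding measurable_cong_sets[OF refl sets_gauss_var]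
      by (cases "i = q"; cases "i = p")
        (auto intro!: borel_measurable_add borel_measurable_diff borel_measurable_times measurable_coord assms i)
  qed (use assms in \<open>auto simp: space_PiM PiE_def extensional_def\<close>)
  finally show ?thesis .
qed

lemma nn_integral_gauss_rot2:
  assumes I: "finite I" "p \<in> I" "q \<in> I" "p \<noteq> q" and cd: "c\<^sup>2 + d\<^sup>2 = 1"
    and F [measurable]: "F \<in> borel_measurable (gauss I)"
  shows "(\<integral>\<^sup>+x. F (rot2 c d p q x) \<partial>gauss I) = (\<integral>\<^sup>+x. F x \<partial>gauss I)"
proof -
  define J where "J = I - {p} - {q}"
  have J: "finite J" "q \<notin> J" "finite (insert q J)" "p \<notin> insert q J" "insert p (insert q J) = I"
    using I by (auto simp: J_def)
  note [measurable] = measurable_rot2[OF I(2,3)]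
  have ex: "(\<integral>\<^sup>+x. G x \<partial>gauss I) = (\<integral>\<^sup>+x. \<integral>\<^sup>+y. \<integral>\<^sup>+z. G (x(q := y, p := z)) \<partial>gauss_var s \<partial>gauss_var s \<partial>gauss J)"
    if G: "G \<in> borel_measurable (gauss I)" for G
  proof -
    have [measurable]: "G \<in> borel_measurable (gauss (insert p (insert q J)))" using G J by simp
    have "(\<integral>\<^sup>+x. G x \<partial>gauss I) = (\<integral>\<^sup>+x. \<integral>\<^sup>+z. G (x(p := z)) \<partial>gauss_var s \<partial>gauss (insert q J))"
      unfolding J(5)[symmetric] by (rule gvp.product_nn_integral_insert) (use J in auto)
    also have "\<dots> = (\<integral>\<^sup>+x. \<integral>\<^sup>+y. \<integral>\<^sup>+z. G (x(q := y, p := z)) \<partial>gauss_var s \<partial>gauss_var s \<partial>gauss J)"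
      using J by (intro gvp.product_nn_integral_insert) auto
    finally show ?thesis .
  qed
  \<comment> \<open>The outer variable \<open>y\<close> sits at \<open>q\<close> and the inner one
    \<open>z\<close> at \<open>p\<close>, so in this order the rotation appears with
    \<open>- d\<close> in place of \<open>d\<close>.\<close>
  have "(\<integral>\<^sup>+x. F (rot2 c d p q x) \<partial>gauss I)
      = (\<integral>\<^sup>+x. \<integral>\<^sup>+y. \<integral>\<^sup>+z. F (x(q := c * y - - d * z, p := - d * y + c * z)) \<partial>gauss_var s \<partial>gauss_var s \<partial>gauss J)"
    unfolding ex[OF measurable_compose[OF measurable_rot2[OF I(2,3)] F]]
    using I by (simp add: rot2_def fun_upd_twist add.commute)
  also have "\<dots> = (\<integral>\<^sup>+x. \<integral>\<^sup>+y. \<integral>\<^sup>+z. F (x(q := y, p := z)) \<partial>gauss_var s \<partial>gauss_var s \<partial>gauss J)"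
  proof (rule nn_integral_cong)
    fix x assume x: "x \<in> space (gauss J)"
    have "(\<lambda>(y, z). x(q := y, p := z)) \<in> measurable (borel \<Otimes>\<^sub>M borel) (gauss I)"
      using x J by (intro measurable_PiM_single')
        (auto simp: space_PiM PiE_def extensional_def case_prod_unfold J(5)[symmetric])
    from measurable_compose[OF this F]
    have "(\<lambda>(y, z). F (x(q := y, p := z))) \<in> borel_measurable (borel \<Otimes>\<^sub>M borel)"
      by (simp add: case_prod_unfold)
    then show "(\<integral>\<^sup>+y. \<integral>\<^sup>+z. F (x(q := c * y - - d * z, p := - d * y + c * z)) \<partial>gauss_var s \<partial>gauss_var s)
        = (\<integral>\<^sup>+y. \<integral>\<^sup>+z. F (x(q := y, p := z)) \<partial>gauss_var s \<partial>gauss_var s)"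
      by (intro nn_integral_gauss_var_rotate[where h = "\<lambda>y z. F (x(q := y, p := z))"] s_pos) (use cd in auto)
  qed
  also have "\<dots> = (\<integral>\<^sup>+x. F x \<partial>gauss I)"
    by (subst ex) auto
  finally show ?thesis .
qed

text \<open>The rows are rotated one at a time: \<open>j\<close> counts those already done while the
  measure stays on the full grid. Row \<open>j\<close> is turned by a single plane rotation in the
  coordinates \<open>(j, p)\<close> and \<open>(j, q)\<close>. Measurability is carried along
  because each step composes with the previous map.\<close>

lemma row_map_rot2:
  assumes "p < n" "q < n" "p \<noteq> q" "c\<^sup>2 + d\<^sup>2 = 1" "j \<le> m"
  shows "row_map j (rot2 c d p q) \<in> measurable (gauss (grid m n)) (gauss (grid m n)) \<and>
    (\<forall>F \<in> borel_measurable (gauss (grid m n)).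
      (\<integral>\<^sup>+x. F (row_map j (rot2 c d p q) x) \<partial>gauss (grid m n)) = (\<integral>\<^sup>+x. F x \<partial>gauss (grid m n)))"
  using \<open>j \<le> m\<close>
proof (induction j)
  case 0
  have "row_map 0 (rot2 c d p q) = (\<lambda>x. x)"
    by (auto simp: row_map_def fun_eq_iff)
  then show ?case by simp
next
  case (Suc j)
  let ?G = "gauss (grid m n)"
  have eq: "row_map (Suc j) (rot2 c d p q) = (\<lambda>x. rot2 c d (j, p) (j, q) (row_map j (rot2 c d p q) x))"
    using assms by (auto simp: row_map_def rot2_def fun_eq_iff less_Suc_eq)
  have m1: "row_map j (rot2 c d p q) \<in> measurable ?G ?G" using Suc by simp
  have m2: "rot2 c d (j, p) (j, q) \<in> measurable ?G ?G"
    by (rule measurable_rot2) (use assms Suc in auto)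
  have "(\<integral>\<^sup>+x. F (rot2 c d (j, p) (j, q) (row_map j (rot2 c d p q) x)) \<partial>?G) = (\<integral>\<^sup>+x. F x \<partial>?G)"
    if F: "F \<in> borel_measurable ?G" for F
  proof -
    have "(\<integral>\<^sup>+x. F (rot2 c d (j, p) (j, q) (row_map j (rot2 c d p q) x)) \<partial>?G)
        = (\<integral>\<^sup>+x. F (rot2 c d (j, p) (j, q) x) \<partial>?G)"
      using Suc.prems by (intro Suc.IH[THEN conjunct2, rule_format] measurable_compose[OF m2 F]) auto
    also have "\<dots> = (\<integral>\<^sup>+x. F x \<partial>?G)"
      using assms Suc F by (intro nn_integral_gauss_rot2) auto
    finally show ?thesis .
  qed
  then show ?case
    unfolding eq using measurable_compose[OF m1 m2] by simp
qed

lemma row_map_rot: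
  assumes "rot n T"
  shows "row_map m T \<in> measurable (gauss (grid m n)) (gauss (grid m n)) \<and>
    (\<forall>F \<in> borel_measurable (gauss (grid m n)).
      (\<integral>\<^sup>+x. F (row_map m T x) \<partial>gauss (grid m n)) = (\<integral>\<^sup>+x. F x \<partial>gauss (grid m n)))"
  using assms
proof (induction rule: rot.induct)
  case rot_id
  have "row_map m (\<lambda>v. v) = (\<lambda>x. x)"
    by (auto simp: row_map_def fun_eq_iff)
  then show ?case by simp
next
  case (rot_step T p q c d)
  let ?G = "gauss (grid m n)"
  have eq: "row_map m (\<lambda>v. rot2 c d p q (T v)) = (\<lambda>x. row_map m (rot2 c d p q) (row_map m T x))"
    by (auto simp: row_map_def fun_eq_iff)
  have r: "row_map m (rot2 c d p q) \<in> measurable ?G ?G"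
    "\<And>F. F \<in> borel_measurable ?G \<Longrightarrow> (\<integral>\<^sup>+x. F (row_map m (rot2 c d p q) x) \<partial>?G) = (\<integral>\<^sup>+x. F x \<partial>?G)"
    using row_map_rot2[of p n q c d m m] rot_step.hyps by auto
  show ?case
    unfolding eq
  proof (intro conjI ballI)
    show "(\<lambda>x. row_map m (rot2 c d p q) (row_map m T x)) \<in> measurable ?G ?G"
      using rot_step.IH r(1) by (auto intro: measurable_compose)
    fix F :: "(nat \<times> nat \<Rightarrow> real) \<Rightarrow> ennreal" assume F: "F \<in> borel_measurable ?G"
    have "(\<integral>\<^sup>+x. F (row_map m (rot2 c d p q) (row_map m T x)) \<partial>?G) = (\<integral>\<^sup>+x. F (row_map m (rot2 c d p q) x) \<partial>?G)"
      by (rule rot_step.IH[THEN conjunct2, rule_format]) (rule measurable_compose[OF r(1) F])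
    then show "(\<integral>\<^sup>+x. F (row_map m (rot2 c d p q) (row_map m T x)) \<partial>?G) = (\<integral>\<^sup>+x. F x \<partial>?G)"
      using r(2)[OF F] by simp
  qed
qed

lemma nn_integral_row_map:
  assumes "rot n T" "F \<in> borel_measurable (gauss (grid m n))"
  shows "(\<integral>\<^sup>+x. F (row_map m T x) \<partial>gauss (grid m n)) = (\<integral>\<^sup>+x. F x \<partial>gauss (grid m n))"
  using row_map_rot assms by blast

lemma measurable_transpose:
  "(\<lambda>x. \<lambda>p\<in>grid m n. x (prod.swap p)) \<in> measurable (gauss (grid n m)) (gauss (grid m n))"
  by (intro measurable_restrict) (auto intro!: measurable_component_singleton)

lemma nn_integral_transpose:
  assumes [measurable]: "F \<in> borel_measurable (gauss (grid m n))"
  shows "(\<integral>\<^sup>+x. F (\<lambda>p\<in>grid m n. x (prod.swap p)) \<partial>gauss (grid n m)) = (\<integral>\<^sup>+x. F x \<partial>gauss (grid m n))"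
proof -
  have "distr (gauss (grid n m)) (gauss (grid m n)) (\<lambda>x. \<lambda>p\<in>grid m n. x (prod.swap p)) = gauss (grid m n)"
    using distr_PiM_reindex[of "grid n m" "\<lambda>_. gauss_var s" prod.swap "grid m n"] gv.prob_space_axioms
    by (simp add: Pi_iff grid_def split: prod.splits)
  moreover have "(\<integral>\<^sup>+x. F x \<partial>distr (gauss (grid n m)) (gauss (grid m n)) (\<lambda>x. \<lambda>p\<in>grid m n. x (prod.swap p)))
      = (\<integral>\<^sup>+x. F (\<lambda>p\<in>grid m n. x (prod.swap p)) \<partial>gauss (grid n m))"
    by (rule nn_integral_distr[OF measurable_transpose]) simp
  ultimately show ?thesis by simp
qed

end

subsection \<open>Gram determinants\<close>

definition entry :: "('i \<Rightarrow> real) \<Rightarrow> ('i \<Rightarrow> real) \<Rightarrow> 'i \<Rightarrow> complex" where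
  "entry A x p = complex_of_real (A p) + \<i> * complex_of_real (x p)"

definition gram :: "nat \<Rightarrow> nat \<Rightarrow> (nat \<times> nat \<Rightarrow> real) \<Rightarrow> (nat \<times> nat \<Rightarrow> real) \<Rightarrow> complex mat" where
  "gram m n A x = mat m m (\<lambda>(i, j). \<Sum>k<n. entry A x (i, k) * cnj (entry A x (j, k)))"

definition gdet :: "nat \<Rightarrow> nat \<Rightarrow> (nat \<times> nat \<Rightarrow> real) \<Rightarrow> (nat \<times> nat \<Rightarrow> real) \<Rightarrow> complex" where
  "gdet m n A x = det (gram m n A x)"

lemma gram_carrier [simp]: "gram m n A x \<in> carrier_mat m m"
  by (simp add: gram_def)

lemma gram_index [simp]: "i < m \<Longrightarrow> j < m \<Longrightarrow>
    gram m n A x $$ (i, j) = (\<Sum>k<n. entry A x (i, k) * cnj (entry A x (j, k)))"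
  by (simp add: gram_def)

lemma gdet_cong:
  assumes "\<And>i k. i < m \<Longrightarrow> k < n \<Longrightarrow> A (i, k) = B (i, k)" "\<And>i k. i < m \<Longrightarrow> k < n \<Longrightarrow> x (i, k) = y (i, k)"
  shows "gdet m n A x = gdet m n B y"
proof -
  have "gram m n A x = gram m n B y"
    unfolding gram_def using assms by (intro cong_mat) (auto intro!: sum.cong simp: entry_def)
  then show ?thesis by (simp add: gdet_def)
qed

text \<open>By the Leibniz formula the determinant is a polynomial in the entries and their
  conjugates. The array is an arbitrary function of \<open>w\<close> so that transposed and glued
  arrays are covered too.\<close>

lemma borel_measurable_gdet:
  assumes "\<And>i k. i < m \<Longrightarrow> k < n \<Longrightarrow> (\<lambda>w. X w (i, k)) \<in> borel_measurable M"
  shows "(\<lambda>w. gdet m n A (X w)) \<in> borel_measurable M"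
proof -
  have "gdet m n A (X w) = (\<Sum>p | p permutes {0..<m}. signof p *
      (\<Prod>i = 0..<m. \<Sum>k<n. entry A (X w) (i, k) * cnj (entry A (X w) (p i, k))))" for w
  proof -
    have "(\<Prod>i = 0..<m. gram m n A (X w) $$ (i, p i))
        = (\<Prod>i = 0..<m. \<Sum>k<n. entry A (X w) (i, k) * cnj (entry A (X w) (p i, k)))"
      if "p permutes {0..<m}" for p
      using permutes_in_image[OF that] by (intro prod.cong refl gram_index) auto
    then show ?thesis
      unfolding gdet_def by (subst det_def'[OF gram_carrier]) (auto intro!: sum.cong)
  qed
  moreover have "(\<lambda>w. \<Sum>p | p permutes {0..<m}. signof p *
      (\<Prod>i = 0..<m. \<Sum>k<n. entry A (X w) (i, k) * cnj (entry A (X w) (p i, k)))) \<in> borel_measurable M"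
  proof (intro borel_measurable_sum borel_measurable_times borel_measurable_prod borel_measurable_const)
    fix p i k assume "p \<in> {p. p permutes {0..<m}}" "i \<in> {0..<m}" "k \<in> {..<n}"
    then have "i < m" "p i < m" "k < n" using permutes_in_image[of p "{0..<m}" i] by auto
    note [measurable] = assms[OF this(1,3)] assms[OF this(2,3)]
    show "(\<lambda>w. entry A (X w) (i, k)) \<in> borel_measurable M"
      unfolding entry_def by measurable
    have "(\<lambda>w. entry A (X w) (p i, k)) \<in> borel_measurable M"
      unfolding entry_def by measurable
    then show "(\<lambda>w. cnj (entry A (X w) (p i, k))) \<in> borel_measurable M"
      by (intro borel_measurable_continuous_on[where f = cnj]) (auto intro: continuous_intros)
  qed
  ultimately show ?thesis by (simp add: fun_eq_iff[symmetric])
qed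

text \<open>A Hermitian product of two rows is a combination of four real inner products between
  rows of \<open>A\<close> and \<open>x\<close>, and \<open>T\<close> preserves each of them. Even
  the Gram matrix is unchanged.\<close>

lemma gdet_row_map:
  assumes "rot n T"
  shows "gdet m n (row_map m T A) (row_map m T x) = gdet m n A x"
proof -
  have inner: "(\<Sum>k<n. entry B y (i, k) * cnj (entry B y (j, k)))
      = complex_of_real ((\<Sum>k<n. B (i, k) * B (j, k)) + (\<Sum>k<n. y (i, k) * y (j, k)))
        + \<i> * complex_of_real ((\<Sum>k<n. y (i, k) * B (j, k)) - (\<Sum>k<n. B (i, k) * y (j, k)))" for B y :: "nat \<times> nat \<Rightarrow> real" and i j
    by (simp add: entry_def algebra_simps sum.distrib sum_subtractf sum_distrib_left)
  have "gram m n (row_map m T A) (row_map m T x) = gram m n A x"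
    unfolding gram_def inner
    by (intro cong_mat) (auto simp: row_map_def rot_inner[OF assms] simp del: of_real_sum of_real_add of_real_diff)
  then show ?thesis by (simp add: gdet_def)
qed

text \<open>Here the Gram matrix does change, into \<open>Q * G * transpose_mat Q\<close> with a
  real orthogonal \<open>Q\<close>; the determinant gains the factor
  \<open>det Q * det Q = 1\<close>.\<close>

lemma gdet_col_map:
  assumes "rot m T"
  shows "gdet m n (row_map n T (A \<circ> prod.swap) \<circ> prod.swap) (row_map n T (x \<circ> prod.swap) \<circ> prod.swap) = gdet m n A x"
    (is "gdet m n ?A ?x = _")
proof -
  obtain R where R: "\<And>v i. i < m \<Longrightarrow> T v i = (\<Sum>k<m. R i k * v k)"
    using rot_matrix[OF assms] by blast
  define Q where "Q = mat m m (\<lambda>(i, j). complex_of_real (R i j))"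
  have Q: "Q \<in> carrier_mat m m" "transpose_mat Q \<in> carrier_mat m m" by (auto simp: Q_def)
  \<comment> \<open>Column \<open>a\<close> of \<open>R\<close> is the image of the
    \<open>a\<close>-th basis vector, so \<open>rot_inner\<close> makes the columns
    orthonormal.\<close>
  have col: "T (\<lambda>k. of_bool (k = a)) i = R i a" if "i < m" "a < m" for i a
    using that by (simp add: R of_bool_def if_distrib[of "\<lambda>x. _ * x"] cong: if_cong)
  have orth: "(\<Sum>i<m. R i a * R i b) = of_bool (a = b)" if "a < m" "b < m" for a b
  proof -
    have "(\<Sum>i<m. R i a * R i b) = (\<Sum>i<m. T (\<lambda>k. of_bool (k = a)) i * T (\<lambda>k. of_bool (k = b)) i)"
      using that col by (intro sum.cong) auto
    also have "\<dots> = (\<Sum>i<m. of_bool (i = a) * of_bool (i = b))"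
      by (rule rot_inner[OF assms])
    also have "\<dots> = of_bool (a = b)"
      using that by (auto simp: of_bool_def if_distrib[of "\<lambda>x. _ * x"] cong: if_cong)
    finally show ?thesis .
  qed
  have "transpose_mat Q * Q = 1\<^sub>m m"
  proof (rule eq_matI)
    fix a b assume "a < dim_row (1\<^sub>m m :: complex mat)" "b < dim_col (1\<^sub>m m :: complex mat)"
    then have ab: "a < m" "b < m" by auto
    have "(transpose_mat Q * Q) $$ (a, b) = complex_of_real (\<Sum>i<m. R i a * R i b)"
      using ab by (simp add: Q_def scalar_prod_def lessThan_atLeast0)
    then show "(transpose_mat Q * Q) $$ (a, b) = 1\<^sub>m m $$ (a, b)"
      using ab orth by simp
  qed (auto simp: Q_def)
  then have det1: "det Q * det Q = 1"
    using det_mult[OF Q(2,1)] det_transpose[OF Q(1)] by simp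
  have ent: "entry ?A ?x (i, k) = (\<Sum>a<m. complex_of_real (R i a) * entry A x (a, k))"
    if "i < m" "k < n" for i k
    using that by (simp add: entry_def row_map_def R sum.distrib sum_distrib_left algebra_simps)
  have "gram m n ?A ?x = Q * gram m n A x * transpose_mat Q"
  proof (rule eq_matI)
    fix i j assume "i < dim_row (Q * gram m n A x * transpose_mat Q)" "j < dim_col (Q * gram m n A x * transpose_mat Q)"
    then have ij: "i < m" "j < m" by (auto simp: Q_def)
    have "gram m n ?A ?x $$ (i, j) = (\<Sum>k<n. (\<Sum>a<m. complex_of_real (R i a) * entry A x (a, k)) *
        (\<Sum>b<m. complex_of_real (R j b) * cnj (entry A x (b, k))))"
      using ij by (simp add: ent)
    also have "\<dots> = (\<Sum>k<n. \<Sum>b<m. \<Sum>a<m. complex_of_real (R i a) * entry A x (a, k) *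
        (complex_of_real (R j b) * cnj (entry A x (b, k))))"
      unfolding sum_product by (rule sum.cong[OF refl], rule sum.swap)
    also have "\<dots> = (\<Sum>b<m. \<Sum>a<m. \<Sum>k<n. complex_of_real (R i a) * entry A x (a, k) *
        (complex_of_real (R j b) * cnj (entry A x (b, k))))"
      by (subst sum.swap) (rule sum.cong[OF refl], rule sum.swap)
    also have "\<dots> = (\<Sum>b<m. (\<Sum>a<m. complex_of_real (R i a) * gram m n A x $$ (a, b)) * complex_of_real (R j b))"
      by (intro sum.cong refl) (simp add: sum_distrib_left sum_distrib_right mult_ac)
    also have "\<dots> = (Q * gram m n A x * transpose_mat Q) $$ (i, j)"
      using ij by (simp add: Q_def scalar_prod_def lessThan_atLeast0 gram_def)
    finally show "gram m n ?A ?x $$ (i, j) = (Q * gram m n A x * transpose_mat Q) $$ (i, j)" .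
  qed (auto simp: Q_def gram_def)
  then have "gdet m n ?A ?x = det Q * gdet m n A x * det Q"
    using Q by (simp add: gdet_def det_mult[OF mult_carrier_mat[OF Q(1) gram_carrier] Q(2)]
      det_mult[OF Q(1) gram_carrier] det_transpose[OF Q(1)])
  also have "\<dots> = gdet m n A x"
    using det1 by (metis mult.assoc mult.commute mult_1)
  finally show ?thesis .
qed

text \<open>Splitting off a row that only has a last entry: the Gram matrix factors as
  \<open>L * diag(G', 1) * L\<^sup>H\<close> with \<open>L\<close> block upper triangular and \<open>G'\<close> the
  Gram matrix without that row and the last column.\<close>

lemma gdet_Suc:
  assumes "\<And>k. k < Suc n \<Longrightarrow> A (m, k) = 0" "\<And>k. k < n \<Longrightarrow> x (m, k) = 0"
  shows "gdet (Suc m) (Suc n) A x = complex_of_real ((x (m, n))\<^sup>2) * gdet m n A x"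
proof -
  define \<rho> where "\<rho> = entry A x (m, n)"
  define w where "w i = entry A x (i, n)" for i
  define W where "W = mat m 1 (\<lambda>(i, _). w i)"
  define W' where "W' = mat 1 m (\<lambda>(_, j). cnj (w j))"
  define r where "r = mat 1 1 (\<lambda>_. \<rho>)"
  define r' where "r' = mat 1 1 (\<lambda>_. cnj \<rho>)"
  define L where "L = four_block_mat (1\<^sub>m m) W (0\<^sub>m 1 m) r"
  define L' where "L' = four_block_mat (1\<^sub>m m) (0\<^sub>m m 1) W' r'"
  define M where "M = four_block_mat (gram m n A x) (0\<^sub>m m 1) (0\<^sub>m 1 m) (1\<^sub>m 1)"
  have c: "W \<in> carrier_mat m 1" "W' \<in> carrier_mat 1 m" "r \<in> carrier_mat 1 1" "r' \<in> carrier_mat 1 1"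
    by (auto simp: W_def W'_def r_def r'_def)
  have z: "entry A x (m, k) = 0" if "k < n" for k
    using assms that by (simp add: entry_def)
  have LM: "L * M = four_block_mat (gram m n A x) W (0\<^sub>m 1 m) r"
    unfolding L_def M_def using c
    by (subst mult_four_block_mat[of _ m m _ 1 _ 1 _ _ m _ 1])
      (auto simp: left_mult_one_mat[OF gram_carrier] left_mult_zero_mat[OF gram_carrier]
        right_add_zero_mat[OF gram_carrier])
  have "L * M * L' = four_block_mat (gram m n A x + W * W') (W * r') (r * W') (r * r')"
    unfolding LM L'_def using c
    by (subst mult_four_block_mat[of _ m m _ 1 _ 1 _ _ m _ 1])
      (auto simp: right_mult_one_mat[OF gram_carrier] right_mult_zero_mat[OF gram_carrier]
        left_add_zero_mat[OF mult_carrier_mat[OF c(1,4)]])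
  also have "\<dots> = gram (Suc m) (Suc n) A x"
  proof (rule eq_matI)
    fix i j assume "i < dim_row (gram (Suc m) (Suc n) A x)" "j < dim_col (gram (Suc m) (Suc n) A x)"
    then have ij: "i < Suc m" "j < Suc m" by (auto simp: gram_def)
    show "four_block_mat (gram m n A x + W * W') (W * r') (r * W') (r * r') $$ (i, j) = gram (Suc m) (Suc n) A x $$ (i, j)"
      using ij c by (cases "i < m"; cases "j < m")
        (auto simp: less_Suc_eq W_def W'_def r_def r'_def scalar_prod_def w_def \<rho>_def z gram_def[of m])
  qed (use c in \<open>auto simp: gram_def\<close>)
  finally have eq: "gram (Suc m) (Suc n) A x = L * M * L'" ..
  have carr: "L \<in> carrier_mat (m + 1) (m + 1)" "M \<in> carrier_mat (m + 1) (m + 1)" "L' \<in> carrier_mat (m + 1) (m + 1)"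
    unfolding L_def M_def L'_def by (rule four_block_carrier_mat; use c in simp)+
  have "det L = \<rho>"
    unfolding L_def using c by (subst det_four_block_mat_lower_left_zero[of _ m _ 1]) (auto simp: r_def det_single)
  moreover have "det L' = cnj \<rho>"
    unfolding L'_def using c by (subst det_four_block_mat_upper_right_zero[of _ m _ 1]) (auto simp: r'_def det_single)
  moreover have "det M = gdet m n A x"
    unfolding M_def gdet_def using c by (subst det_four_block_mat_upper_right_zero[of _ m _ 1]) auto
  ultimately have "gdet (Suc m) (Suc n) A x = \<rho> * gdet m n A x * cnj \<rho>"
    unfolding gdet_def[of "Suc m"] eq
    by (simp add: det_mult[OF mult_carrier_mat[OF carr(1,2)] carr(3)] det_mult[OF carr(1,2)])
  \<comment> \<open>Since \<open>A (m, n) = 0\<close>, the pivot \<open>\<rho>\<close> is purely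
    imaginary.\<close>
  moreover have "\<rho> * cnj \<rho> = complex_of_real ((x (m, n))\<^sup>2)"
    using assms(1)[of n] by (simp add: \<rho>_def entry_def power2_eq_square complex_eq_iff)
  ultimately show ?thesis by (simp add: mult_ac)
qed

lemma gdet_one:
  "gdet 1 n A x = complex_of_real ((\<Sum>k<n. (A (0, k))\<^sup>2) + (\<Sum>k<n. (x (0, k))\<^sup>2))"
proof -
  have "gram 1 n A x = mat 1 1 (\<lambda>_. complex_of_real ((\<Sum>k<n. (A (0, k))\<^sup>2) + (\<Sum>k<n. (x (0, k))\<^sup>2)))"
    by (intro eq_matI) (auto simp: entry_def gram_def algebra_simps power2_eq_square sum.distrib)
  then show ?thesis by (simp add: gdet_def det_single)
qed

text \<open>Two stages: \<open>T1\<close> collects the coordinates strictly between 0 and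
  \<open>n\<close> into the last one and fixes the first axis; \<open>T2\<close> then rotates in the
  plane of the coordinates 0 and \<open>n\<close>. Hence the image of the corner row stays in that
  plane, and once the last column is gone it has a single entry again. The square of this entry
  follows from the preserved norm and the preserved inner product with \<open>v\<close>. The last
  formula is multiplied by the squared norm instead of divided by it, so it also holds for
  \<open>v\<close> of norm 0.\<close>

lemma rot_align:
  assumes "n \<ge> 1"
  obtains T where "rot (Suc n) T" "\<And>k. k < n \<Longrightarrow> T v k = 0" "(T v n)\<^sup>2 = (\<Sum>k<Suc n. (v k)\<^sup>2)"
    "T (\<lambda>_. 0) = (\<lambda>_. 0)"
    "\<And>k. 0 < k \<Longrightarrow> k < n \<Longrightarrow> T (\<lambda>k. if k = 0 then t else 0) k = 0"
    "(T (\<lambda>k. if k = 0 then t else 0) 0)\<^sup>2 * (\<Sum>k<Suc n. (v k)\<^sup>2) = t\<^sup>2 * (\<Sum>k\<in>{..<Suc n} - {0}. (v k)\<^sup>2)"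
proof -
  let ?e = "\<lambda>k::nat. if k = 0 then t else 0"
  obtain T1 where T1: "rot (Suc n) T1" "\<And>k. k \<in> {1..<n} \<Longrightarrow> T1 v k = 0"
    "(T1 v n)\<^sup>2 = (v n)\<^sup>2 + (\<Sum>k\<in>{1..<n}. (v k)\<^sup>2)"
    "\<And>w k. k \<notin> insert n {1..<n} \<Longrightarrow> T1 w k = w k" "\<And>w. (\<And>k. k \<in> insert n {1..<n} \<Longrightarrow> w k = 0) \<Longrightarrow> T1 w = w"
    by (rule rot_reduceE[of "{1..<n}" "Suc n" n v]) auto
  obtain T2 where T2: "rot (Suc n) T2" "\<And>k. k \<in> {0} \<Longrightarrow> T2 (T1 v) k = 0"
    "(T2 (T1 v) n)\<^sup>2 = (T1 v n)\<^sup>2 + (\<Sum>k\<in>{0}. (T1 v k)\<^sup>2)"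
    "\<And>w k. k \<notin> insert n {0} \<Longrightarrow> T2 w k = w k" "\<And>w. (\<And>k. k \<in> insert n {0} \<Longrightarrow> w k = 0) \<Longrightarrow> T2 w = w"
    by (rule rot_reduceE[of "{0}" "Suc n" n "T1 v"]) (use assms in auto)
  define T where "T v = T2 (T1 v)" for v
  have rT: "rot (Suc n) T" unfolding T_def using T2(1) T1(1) by (rule rot_comp)
  have Te: "T1 ?e = ?e" using assms by (intro T1(5)) auto
  have split: "{..<Suc n} = insert 0 (insert n {1..<n})" using assms by auto
  have v0: "T v k = 0" if "k < n" for k
    using that T1(2)[of k] T2(2)[of 0] T2(4)[of k "T1 v"] by (cases "k = 0") (auto simp: T_def)
  have e0: "T ?e k = 0" if "0 < k" "k < n" for k
    using that T2(4)[of k ?e] by (auto simp: T_def Te)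
  have vn: "(T v n)\<^sup>2 = (\<Sum>k<Suc n. (v k)\<^sup>2)"
    using T2(3) T1(3) T1(4)[of 0 v] assms unfolding split by (simp add: T_def)
  have norm: "(T ?e 0)\<^sup>2 = t\<^sup>2 - (T ?e n)\<^sup>2"
  proof -
    have "(\<Sum>k<Suc n. T ?e k * T ?e k) = (\<Sum>k<Suc n. ?e k * ?e k)" by (rule rot_inner[OF rT])
    moreover have "(\<Sum>k\<in>{1..<n}. T ?e k * T ?e k) = 0" "(\<Sum>k\<in>{1..<n}. ?e k * ?e k) = 0"
      using e0 by (auto intro!: sum.neutral)
    ultimately show ?thesis
      using assms unfolding split by (simp add: power2_eq_square)
  qed
  have "T ?e n * T v n = t * v 0"
  proof -
    have "(\<Sum>k<Suc n. T ?e k * T v k) = (\<Sum>k<Suc n. ?e k * v k)" by (rule rot_inner[OF rT])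
    moreover have "(\<Sum>k<n. T ?e k * T v k) = 0"
      using v0 by (intro sum.neutral) auto
    moreover have "(\<Sum>k<Suc n. ?e k * v k) = t * v 0"
      by (simp add: if_distrib[of "\<lambda>x. x * _"] sum.delta cong: if_cong)
    ultimately show ?thesis by simp
  qed
  then have inner: "(T ?e n)\<^sup>2 * (T v n)\<^sup>2 = t\<^sup>2 * (v 0)\<^sup>2"
    by (metis power_mult_distrib)
  have "(\<Sum>k<Suc n. (v k)\<^sup>2) = (v 0)\<^sup>2 + (\<Sum>k\<in>{..<Suc n} - {0}. (v k)\<^sup>2)"
    by (intro sum.remove) auto
  then have "(T ?e 0)\<^sup>2 * (\<Sum>k<Suc n. (v k)\<^sup>2) = t\<^sup>2 * (\<Sum>k\<in>{..<Suc n} - {0}. (v k)\<^sup>2)"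
    using inner unfolding norm vn by (simp add: left_diff_distrib distrib_left)
  moreover have "T (\<lambda>_. 0) = (\<lambda>_. 0)"
    using T1(5)[of "\<lambda>_. 0", OF refl] T2(5)[of "\<lambda>_. 0", OF refl] by (simp add: T_def)
  ultimately show ?thesis
    using that[OF rT v0 vn _ e0] by blast
qed

subsection \<open>Reduction of the random Gram determinant\<close>

definition corner :: "real \<Rightarrow> nat \<times> nat \<Rightarrow> real" where
  "corner t = (\<lambda>(i, k). if i = 0 \<and> k = 0 then t else 0)"

context gaussian
begin

definition gint :: "nat \<Rightarrow> nat \<Rightarrow> (nat \<times> nat \<Rightarrow> real) \<Rightarrow> (complex \<Rightarrow> ennreal) \<Rightarrow> ennreal" where
  "gint m n A f = (\<integral>\<^sup>+x. f (gdet m n A x) \<partial>gauss (grid m n))"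

lemma gint_cong:
  assumes "\<And>i k. i < m \<Longrightarrow> k < n \<Longrightarrow> A (i, k) = B (i, k)"
  shows "gint m n A f = gint m n B f"
  unfolding gint_def using gdet_cong[of m n A B, OF assms] by simp

lemma borel_measurable_gdet_grid [measurable]: "gdet m n A \<in> borel_measurable (gauss (grid m n))"
proof (rule borel_measurable_gdet)
  fix i k assume "i < m" "k < n"
  then have "(i, k) \<in> grid m n" by simp
  from measurable_coord[OF this]
  show "(\<lambda>w. w (i, k)) \<in> borel_measurable (gauss (grid m n))" by simp
qed

lemma gint_row_map:
  assumes T: "rot n T" and [measurable]: "f \<in> borel_measurable borel"
  shows "gint m n (row_map m T A) f = gint m n A f"
proof -
  have "gint m n A f = (\<integral>\<^sup>+x. f (gdet m n (row_map m T A) (row_map m T x)) \<partial>gauss (grid m n))"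
    by (simp add: gint_def gdet_row_map[OF T])
  also have "\<dots> = gint m n (row_map m T A) f"
    unfolding gint_def by (intro nn_integral_row_map[OF T]) measurable
  finally show ?thesis ..
qed

lemma borel_measurable_gdet_swap [measurable]:
  "(\<lambda>y. gdet m n A (y \<circ> prod.swap)) \<in> borel_measurable (gauss (grid n m))"
proof (rule borel_measurable_gdet)
  fix i k assume "i < m" "k < n"
  then have "(k, i) \<in> grid n m" by simp
  from measurable_coord[OF this]
  show "(\<lambda>w. (w \<circ> prod.swap) (i, k)) \<in> borel_measurable (gauss (grid n m))" by simp
qed

text \<open>Used twice: to rotate columns as if they were rows, and to reduce the case of more rows
  than columns to the other one.\<close>

lemma gint_swap:
  assumes [measurable]: "f \<in> borel_measurable borel"
  shows "gint m n A f = (\<integral>\<^sup>+y. f (gdet m n A (y \<circ> prod.swap)) \<partial>gauss (grid n m))"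
proof -
  have "gint m n A f = (\<integral>\<^sup>+y. f (gdet m n A (\<lambda>p\<in>grid m n. y (prod.swap p))) \<partial>gauss (grid n m))"
    unfolding gint_def by (rule nn_integral_transpose[symmetric]) measurable
  also have "\<dots> = (\<integral>\<^sup>+y. f (gdet m n A (y \<circ> prod.swap)) \<partial>gauss (grid n m))"
    by (intro nn_integral_cong arg_cong[where f = f] gdet_cong) auto
  finally show ?thesis .
qed

lemma gint_col_map:
  assumes T: "rot m T" and [measurable]: "f \<in> borel_measurable borel"
  shows "gint m n (row_map n T (A \<circ> prod.swap) \<circ> prod.swap) f = gint m n A f" (is "gint m n ?A f = _")
proof -
  have "gint m n ?A f = (\<integral>\<^sup>+y. f (gdet m n ?A (row_map n T y \<circ> prod.swap)) \<partial>gauss (grid n m))"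
    unfolding gint_swap[OF assms(2)] by (intro nn_integral_row_map[OF T, symmetric]) measurable
  also have "\<dots> = (\<integral>\<^sup>+y. f (gdet m n A (y \<circ> prod.swap)) \<partial>gauss (grid n m))"
  proof (intro nn_integral_cong arg_cong[where f = f])
    fix y :: "nat \<times> nat \<Rightarrow> real"
    have "y = (y \<circ> prod.swap) \<circ> prod.swap" by (simp add: comp_assoc)
    then show "gdet m n ?A (row_map n T y \<circ> prod.swap) = gdet m n A (y \<circ> prod.swap)"
      using gdet_col_map[OF T, of n A "y \<circ> prod.swap"] by simp
  qed
  finally show ?thesis by (simp add: gint_swap)
qed

text \<open>All rows are equal, so one rotation turns each into \<open>a\<close> times the first
  basis vector with \<open>a\<^sup>2 = n\<close>. What remains is a constant first column, which a
  rotation of the columns shrinks to one entry with square \<open>m * a\<^sup>2\<close>.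
  Eliminations fix that entry only up to sign, hence the statement about
  \<open>t\<^sup>2\<close>.\<close>

lemma gint_ones:
  assumes "m \<ge> 1" "n \<ge> 1" and f: "f \<in> borel_measurable borel"
  obtains t where "t\<^sup>2 = real n * real m" "gint m n (\<lambda>_. 1) f = gint m n (corner t) f"
proof -
  obtain T where T: "rot n T" "\<And>k. k \<in> {1..<n} \<Longrightarrow> T (\<lambda>_. 1) k = 0"
    "(T (\<lambda>_. 1) 0)\<^sup>2 = 1\<^sup>2 + (\<Sum>k\<in>{1..<n}. 1\<^sup>2)"
    by (rule rot_reduceE[of "{1..<n}" n 0 "\<lambda>_. 1"]) (use assms in auto)
  define a where "a = T (\<lambda>_. 1) 0"
  obtain U where U: "rot m U" "\<And>k. k \<in> {1..<m} \<Longrightarrow> U (\<lambda>_. a) k = 0"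
    "(U (\<lambda>_. a) 0)\<^sup>2 = a\<^sup>2 + (\<Sum>k\<in>{1..<m}. a\<^sup>2)"
    "\<And>w. (\<And>k. k \<in> insert 0 {1..<m} \<Longrightarrow> w k = 0) \<Longrightarrow> U w = w"
    by (rule rot_reduceE[of "{1..<m}" m 0 "\<lambda>_. a"]) (use assms in auto)
  have U0: "U (\<lambda>_. 0) = (\<lambda>_. 0)" by (rule U) auto
  define t where "t = U (\<lambda>_. a) 0"
  let ?B = "\<lambda>(i, k). if k = 0 then a else 0 :: real"
  have "gint m n (\<lambda>_. 1) f = gint m n (row_map m T (\<lambda>_. 1)) f"
    by (rule gint_row_map[OF T(1) f, symmetric])
  also have "\<dots> = gint m n ?B f"
    by (rule gint_cong) (use T(2) in \<open>auto simp: row_map_def a_def\<close>)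
  also have "\<dots> = gint m n (row_map n U (?B \<circ> prod.swap) \<circ> prod.swap) f"
    by (rule gint_col_map[OF U(1) f, symmetric])
  also have "\<dots> = gint m n (corner t) f"
    by (rule gint_cong) (use U(2) in \<open>auto simp: row_map_def corner_def t_def U0\<close>)
  finally have "gint m n (\<lambda>_. 1) f = gint m n (corner t) f" .
  moreover have "t\<^sup>2 = real n * real m"
    using U(3) T(3) assms by (simp add: t_def a_def of_nat_diff algebra_simps)
  ultimately show ?thesis by (rule that[rotated])
qed

section \<open>Splitting off the last row\<close>

definition glue :: "nat \<Rightarrow> (nat \<times> nat \<Rightarrow> real) \<Rightarrow> (nat \<times> nat \<Rightarrow> real) \<Rightarrow> nat \<times> nat \<Rightarrow> real" where
  "glue m x \<phi> = (\<lambda>(i, k). if i < m then x (i, k) else \<phi> (i, k))"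

lemma borel_measurable_gdet_glue:
  "(\<lambda>x. gdet (Suc m) n A (glue m x \<phi>)) \<in> borel_measurable (gauss (grid m n))"
proof (rule borel_measurable_gdet)
  fix i k assume "i < Suc m" "k < n"
  show "(\<lambda>x. glue m x \<phi> (i, k)) \<in> borel_measurable (gauss (grid m n))"
  proof (cases "i < m")
    case True
    then have "(i, k) \<in> grid m n" using \<open>k < n\<close> by simp
    from measurable_coord[OF this]
    show ?thesis using True by (simp add: glue_def)
  qed (simp add: glue_def)
qed

lemma gint_peel_row:
  assumes [measurable]: "f \<in> borel_measurable borel"
  shows "gint (Suc m) n A f = (\<integral>\<^sup>+\<phi>. \<integral>\<^sup>+x. f (gdet (Suc m) n A (glue m x \<phi>)) \<partial>gauss (grid m n) \<partial>gauss ({m} \<times> {..<n}))"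
proof -
  have un: "grid (Suc m) n = {m} \<times> {..<n} \<union> grid m n" by (auto simp: grid_def)
  have "gint (Suc m) n A f = (\<integral>\<^sup>+\<phi>. \<integral>\<^sup>+x. f (gdet (Suc m) n A (merge ({m} \<times> {..<n}) (grid m n) (\<phi>, x)))
      \<partial>gauss (grid m n) \<partial>gauss ({m} \<times> {..<n}))"
    unfolding gint_def un
  proof (rule gvp.product_nn_integral_fold)
    show "{m} \<times> {..<n} \<inter> grid m n = {}" by (auto simp: grid_def)
    show "(\<lambda>x. f (gdet (Suc m) n A x)) \<in> borel_measurable (gauss ({m} \<times> {..<n} \<union> grid m n))"
      unfolding un[symmetric] by measurable
  qed auto
  also have "\<dots> = (\<integral>\<^sup>+\<phi>. \<integral>\<^sup>+x. f (gdet (Suc m) n A (glue m x \<phi>)) \<partial>gauss (grid m n) \<partial>gauss ({m} \<times> {..<n}))"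
    by (intro nn_integral_cong arg_cong[where f = f] gdet_cong) (auto simp: merge_def glue_def)
  finally show ?thesis .
qed

text \<open>After a row has been split off, the last column of the other rows is no longer read and
  is integrated out as a marginal.\<close>

lemma gint_drop_col:
  assumes [measurable]: "f \<in> borel_measurable borel"
  shows "(\<integral>\<^sup>+x. f (gdet m n A x) \<partial>gauss (grid m (Suc n))) = gint m n A f"
proof -
  have sub: "grid m n \<subseteq> grid m (Suc n)" by (auto simp: grid_def)
  have "gint m n A f = (\<integral>\<^sup>+x. f (gdet m n A x) \<partial>distr (gauss (grid m (Suc n))) (gauss (grid m n)) (\<lambda>x. restrict x (grid m n)))"
    unfolding gint_def using gvp.distr_restrict[OF sub] by simp
  also have "\<dots> = (\<integral>\<^sup>+x. f (gdet m n A (restrict x (grid m n))) \<partial>gauss (grid m (Suc n)))"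
    by (intro nn_integral_distr measurable_restrict_subset sub) simp
  also have "\<dots> = (\<integral>\<^sup>+x. f (gdet m n A x) \<partial>gauss (grid m (Suc n)))"
    by (intro nn_integral_cong arg_cong[where f = f] gdet_cong) auto
  finally show ?thesis ..
qed

text \<open>The orthogonal map that moves \<open>\<phi>\<close> to the last axis depends on \<open>\<phi>\<close>, but it is only used
  inside the integral over the other rows, so no measurable choice is needed.\<close>

lemma gint_fixed_row:
  fixes \<phi> :: "nat \<times> nat \<Rightarrow> real"
  assumes "m \<ge> 1" "n \<ge> 1" and f [measurable]: "f \<in> borel_measurable borel"
  defines "r \<equiv> \<Sum>k<Suc n. (\<phi> (m, k))\<^sup>2"
  obtains w where "w\<^sup>2 * r = t\<^sup>2 * (\<Sum>k\<in>{..<Suc n} - {0}. (\<phi> (m, k))\<^sup>2)"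
    "(\<integral>\<^sup>+x. f (gdet (Suc m) (Suc n) (corner t) (glue m x \<phi>)) \<partial>gauss (grid m (Suc n)))
      = gint m n (corner w) (\<lambda>z. f (complex_of_real r * z))"
proof -
  let ?v = "\<lambda>k. \<phi> (m, k)" and ?e = "\<lambda>k::nat. if k = 0 then t else 0" and ?G = "gauss (grid m (Suc n))"
  obtain T where T: "rot (Suc n) T" "\<And>k. k < n \<Longrightarrow> T ?v k = 0" "(T ?v n)\<^sup>2 = (\<Sum>k<Suc n. (?v k)\<^sup>2)"
    "T (\<lambda>_. 0) = (\<lambda>_. 0)" "\<And>k. 0 < k \<Longrightarrow> k < n \<Longrightarrow> T ?e k = 0"
    "(T ?e 0)\<^sup>2 * (\<Sum>k<Suc n. (?v k)\<^sup>2) = t\<^sup>2 * (\<Sum>k\<in>{..<Suc n} - {0}. (?v k)\<^sup>2)"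
    using rot_align[OF assms(2), where v = ?v and t = t] by blast
  define w where "w = T ?e 0"
  define B where "B = row_map (Suc m) T (corner t)"
  \<comment> \<open>The rotated last row, repeated in every row; \<open>glue m\<close> followed by
    \<open>gdet (Suc m)\<close> reads it in row \<open>m\<close> only.\<close>
  define \<psi> where "\<psi> = (\<lambda>(i :: nat, k). T ?v k)"
  \<comment> \<open>As \<open>m \<ge> 1\<close>, the row split off is not the corner row, so its
    real part is the zero vector, which \<open>T\<close> fixes.\<close>
  have B: "B (m, k) = 0" for k
    using assms(1) T(4) by (simp add: B_def row_map_def corner_def)
  have Bw: "B (i, k) = corner w (i, k)" if "i < m" "k < n" for i k
    using that T(4,5) by (cases "i = 0"; cases "k = 0") (simp_all add: B_def row_map_def corner_def w_def)
  have "(\<integral>\<^sup>+x. f (gdet (Suc m) (Suc n) (corner t) (glue m x \<phi>)) \<partial>?G)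
      = (\<integral>\<^sup>+x. f (gdet (Suc m) (Suc n) B (row_map (Suc m) T (glue m x \<phi>))) \<partial>?G)"
    by (simp add: B_def gdet_row_map[OF T(1)])
  also have "\<dots> = (\<integral>\<^sup>+x. f (gdet (Suc m) (Suc n) B (glue m (row_map m T x) \<psi>)) \<partial>?G)"
    by (intro nn_integral_cong arg_cong[where f = f] gdet_cong)
      (auto simp: row_map_def glue_def \<psi>_def less_Suc_eq)
  also have "\<dots> = (\<integral>\<^sup>+x. f (gdet (Suc m) (Suc n) B (glue m x \<psi>)) \<partial>?G)"
    by (rule nn_integral_row_map[OF T(1)])
      (rule measurable_compose[OF borel_measurable_gdet_glue f])
  also have "\<dots> = (\<integral>\<^sup>+x. f (complex_of_real r * gdet m n (corner w) x) \<partial>?G)"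
  proof (intro nn_integral_cong arg_cong[where f = f])
    fix x :: "nat \<times> nat \<Rightarrow> real"
    have "gdet (Suc m) (Suc n) B (glue m x \<psi>) = complex_of_real r * gdet m n B (glue m x \<psi>)"
      using B T(2,3) by (subst gdet_Suc) (auto simp: glue_def \<psi>_def r_def)
    also have "gdet m n B (glue m x \<psi>) = gdet m n (corner w) x"
      using Bw by (intro gdet_cong) (auto simp: glue_def)
    finally show "gdet (Suc m) (Suc n) B (glue m x \<psi>) = complex_of_real r * gdet m n (corner w) x" .
  qed
  also have "\<dots> = gint m n (corner w) (\<lambda>z. f (complex_of_real r * z))"
    by (rule gint_drop_col) measurable
  finally show ?thesis
    using T(6) by (intro that[of w]) (simp_all add: w_def r_def)
qed

lemma gint_one:
  assumes "n \<ge> 1" and [measurable]: "f \<in> borel_measurable borel"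
  shows "gint 1 n (corner w) f = (\<integral>\<^sup>+y. f (complex_of_real (y + w\<^sup>2)) \<partial>chi2 n s)"
proof -
  have "gdet 1 n (corner w) x = complex_of_real ((\<Sum>p\<in>grid 1 n. (x p)\<^sup>2) + w\<^sup>2)" for x
  proof -
    have "(\<Sum>p\<in>grid 1 n. (x p)\<^sup>2) = (\<Sum>k<n. (x (0, k))\<^sup>2)"
      unfolding grid_def using sum.cartesian_product[of "\<lambda>i k. (x (i, k))\<^sup>2" "{..<n}" "{..<1}"] by (simp add: case_prod_unfold)
    moreover have "(\<Sum>k<n. (corner w (0, k))\<^sup>2) = w\<^sup>2"
    proof -
      have "(\<Sum>k<n. (corner w (0, k))\<^sup>2) = (\<Sum>k<n. if k = 0 then w\<^sup>2 else 0)"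
        by (intro sum.cong) (auto simp: corner_def)
      then show ?thesis using assms by simp
    qed
    ultimately show ?thesis unfolding gdet_one by (simp add: add.commute)
  qed
  moreover have "(\<integral>\<^sup>+x. f (complex_of_real ((\<Sum>p\<in>grid 1 n. (x p)\<^sup>2) + w\<^sup>2)) \<partial>gauss (grid 1 n))
      = (\<integral>\<^sup>+y. f (complex_of_real (y + w\<^sup>2)) \<partial>chi2 (card (grid 1 n)) s)"
    by (rule gauss_sum_squares_chi2[where h = "\<lambda>y. f (complex_of_real (y + w\<^sup>2))"])
      (use assms in \<open>auto simp: grid_def lessThan_empty_iff\<close>)
  ultimately show ?thesis by (simp add: gint_def grid_def)
qed

text \<open>The new squared corner entry is prescribed by \<open>r * q = r * w\<^sup>2\<close> and
  not by \<open>q = w\<^sup>2\<close>. When the split row is zero, the quotient of sums has the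
  value 0 by the division convention and carries no information on \<open>w\<close>, but then
  \<open>r = 0\<close> makes the weaker equation true. The null event thus needs no treatment of its
  own.\<close>

lemma gint_recursion:
  assumes mn: "m \<ge> 1" "n \<ge> 1" and f [measurable]: "f \<in> borel_measurable borel"
    and h [measurable]: "(\<lambda>(r, u). h r u) \<in> borel_measurable (borel \<Otimes>\<^sub>M borel)"
    and eq: "\<And>r w q. r * q = r * w\<^sup>2 \<Longrightarrow> gint m n (corner w) (\<lambda>z. f (complex_of_real r * z)) = h r q"
  shows "gint (Suc m) (Suc n) (corner t) f
    = (\<integral>\<^sup>+r. \<integral>\<^sup>+u. h r (t\<^sup>2 * u) \<partial>beta_dist (n / 2) (1 / 2) \<partial>chi2 (Suc n) s)"
proof -
  let ?I = "{m} \<times> {..<Suc n}"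
  have sums: "(\<Sum>p\<in>?I. g p) = (\<Sum>k<Suc n. g (m, k))" "(\<Sum>p\<in>?I - {(m, 0)}. g p) = (\<Sum>k\<in>{..<Suc n} - {0}. g (m, k))"
    for g :: "nat \<times> nat \<Rightarrow> real"
  proof -
    show "(\<Sum>p\<in>?I. g p) = (\<Sum>k<Suc n. g (m, k))"
      by (rule sum.reindex_bij_witness[of _ "\<lambda>k. (m, k)" snd]) auto
    show "(\<Sum>p\<in>?I - {(m, 0)}. g p) = (\<Sum>k\<in>{..<Suc n} - {0}. g (m, k))"
      by (rule sum.reindex_bij_witness[of _ "\<lambda>k. (m, k)" snd]) auto
  qed
  have "gint (Suc m) (Suc n) (corner t) f = (\<integral>\<^sup>+\<phi>. h (\<Sum>p\<in>?I. (\<phi> p)\<^sup>2)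
      (t\<^sup>2 * ((\<Sum>p\<in>?I - {(m, 0)}. (\<phi> p)\<^sup>2) / (\<Sum>p\<in>?I. (\<phi> p)\<^sup>2))) \<partial>gauss ?I)"
    unfolding gint_peel_row[OF f]
  proof (rule nn_integral_cong)
    fix \<phi> :: "nat \<times> nat \<Rightarrow> real"
    let ?r = "\<Sum>k<Suc n. (\<phi> (m, k))\<^sup>2" and ?rest = "\<Sum>k\<in>{..<Suc n} - {0}. (\<phi> (m, k))\<^sup>2"
    obtain w where w: "w\<^sup>2 * ?r = t\<^sup>2 * ?rest"
      "(\<integral>\<^sup>+x. f (gdet (Suc m) (Suc n) (corner t) (glue m x \<phi>)) \<partial>gauss (grid m (Suc n)))
      = gint m n (corner w) (\<lambda>z. f (complex_of_real ?r * z))"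
      by (rule gint_fixed_row[OF mn f, of \<phi> t])
    have "?r = 0 \<Longrightarrow> ?rest = 0"
      by (simp add: sum_nonneg_eq_0_iff del: sum.lessThan_Suc)
    then have "?r * (t\<^sup>2 * (?rest / ?r)) = ?r * w\<^sup>2"
      using w(1) by (cases "?r = 0") (simp_all add: mult.commute del: sum.lessThan_Suc)
    then have "gint m n (corner w) (\<lambda>z. f (complex_of_real ?r * z)) = h ?r (t\<^sup>2 * (?rest / ?r))"
      by (rule eq)
    then show "(\<integral>\<^sup>+x. f (gdet (Suc m) (Suc n) (corner t) (glue m x \<phi>)) \<partial>gauss (grid m (Suc n)))
      = h (\<Sum>p\<in>?I. (\<phi> p)\<^sup>2) (t\<^sup>2 * ((\<Sum>p\<in>?I - {(m, 0)}. (\<phi> p)\<^sup>2) / (\<Sum>p\<in>?I. (\<phi> p)\<^sup>2)))"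
      unfolding sums w(2) .
  qed
  also have "\<dots> = (\<integral>\<^sup>+r. \<integral>\<^sup>+u. h r (t\<^sup>2 * u) \<partial>beta_dist ((real (card ?I) - 1) / 2) (1 / 2) \<partial>chi2 (card ?I) s)"
    by (rule gauss_norm_angle[where h = "\<lambda>r u. h r (t\<^sup>2 * u)"]) (use mn in auto)
  also have "card ?I = Suc n" by simp
  finally show ?thesis by simp
qed

section \<open>Induction on the number of rows\<close>

sublocale chi: product_prob_space "\<lambda>n. chi2 n s" I for I
  by (intro product_prob_spaceI prob_space_chi2)

text \<open>The claimed law for \<open>m + 1\<close> rows and \<open>n\<close> columns, written as
  iterated integrals with \<open>q\<close> for the squared corner entry. The chi-square variables of
  the product are indexed by their degrees of freedom, so that one more row inserts one more
  index.\<close>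

definition law :: "nat \<Rightarrow> nat \<Rightarrow> real \<Rightarrow> (complex \<Rightarrow> ennreal) \<Rightarrow> ennreal" where
  "law m n q f = (\<integral>\<^sup>+p. \<integral>\<^sup>+b. \<integral>\<^sup>+x. f (complex_of_real ((x + q * b) * (\<Prod>i\<in>{n - m + 1..n}. p i)))
     \<partial>chi2 (n - m) s \<partial>beta_dist (real (n - m) / 2) (m / 2) \<partial>PiM {n - m + 1..n} (\<lambda>i. chi2 i s))"

text \<open>The base case has two rows, since for one row the second beta parameter
  \<open>m / 2\<close> would be 0. In the step \<open>gint_recursion\<close> supplies a chi-square
  variable of \<open>n\<close> degrees of freedom and a beta variable \<open>u\<close>;
  \<open>u\<close> multiplies the beta variable of the induction hypothesis, and
  \<open>nn_integral_beta_beta\<close> merges the two.\<close>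

lemma gint_corner:
  assumes "m \<ge> 1" "n > m" "f \<in> borel_measurable borel"
  shows "gint (Suc m) n (corner t) f = law m n (t\<^sup>2) f"
  using assms
proof (induction m arbitrary: n t f rule: nat_induct_at_least)
  case base
  then have [measurable]: "f \<in> borel_measurable borel" by simp
  obtain n' where n': "n = Suc n'" "n' \<ge> 1" using base by (cases n) auto
  interpret chi': prob_space "chi2 n' s" by (rule prob_space_chi2)
  interpret B: sigma_finite_measure "beta_dist (n' / 2) (1 / 2)" by (rule sigma_finite_beta_dist)
  have "gint (Suc 1) (Suc n') (corner t) f = (\<integral>\<^sup>+r. \<integral>\<^sup>+u. \<integral>\<^sup>+y. f (complex_of_real (r * (y + t\<^sup>2 * u)))
      \<partial>chi2 n' s \<partial>beta_dist (n' / 2) (1 / 2) \<partial>chi2 (Suc n') s)"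
  proof (rule gint_recursion[where h = "\<lambda>r q. \<integral>\<^sup>+y. f (complex_of_real (r * (y + q))) \<partial>chi2 n' s"])
    fix r w q :: real assume eq: "r * q = r * w\<^sup>2"
    have "complex_of_real r * complex_of_real (y + w\<^sup>2) = complex_of_real (r * (y + q))" for y
      by (simp only: of_real_mult[symmetric] distrib_left eq)
    moreover have "gint 1 n' (corner w) (\<lambda>z. f (complex_of_real r * z))
        = (\<integral>\<^sup>+y. f (complex_of_real r * complex_of_real (y + w\<^sup>2)) \<partial>chi2 n' s)"
      by (rule gint_one) (use n' in auto)
    ultimately show "gint 1 n' (corner w) (\<lambda>z. f (complex_of_real r * z)) = (\<integral>\<^sup>+y. f (complex_of_real (r * (y + q))) \<partial>chi2 n' s)"
      by (simp only:)
  qed (use n' in auto)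
  also have "\<dots> = law 1 n (t\<^sup>2) f"
    unfolding law_def n' by (subst chi.product_nn_integral_singleton[symmetric]) (auto simp: mult.commute)
  finally show ?case by (simp add: n')
next
  case (Suc m)
  then have f [measurable]: "f \<in> borel_measurable borel" by simp
  obtain n' where n': "n = Suc n'" "n' > m" "n' \<ge> 1" using Suc by (cases n) auto
  define a where "a = real (n' - m) / 2"
  define P where "P = PiM {n' - m + 1..n'} (\<lambda>i. chi2 i s)"
  interpret chi': prob_space "chi2 (n' - m) s" by (rule prob_space_chi2)
  interpret P: prob_space P unfolding P_def by (intro prob_space_PiM prob_space_chi2)
  interpret B: sigma_finite_measure "beta_dist a (m / 2)" by (rule sigma_finite_beta_dist)
  interpret B1: sigma_finite_measure "beta_dist (n' / 2) (1 / 2)" by (rule sigma_finite_beta_dist)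
  interpret B2: sigma_finite_measure "beta_dist a (m / 2 + 1 / 2)" by (rule sigma_finite_beta_dist)
  interpret PB: pair_sigma_finite P "beta_dist (n' / 2) (1 / 2)" ..
  \<comment> \<open>The second equation is the matching condition for the merge: the first parameter
    \<open>n' / 2\<close> of the new beta variable is the sum of the parameters \<open>a\<close> and
    \<open>m / 2\<close> of the old one.\<close>
  have a: "a > 0" "a + m / 2 = n' / 2"
    using n' by (auto simp: a_def of_nat_diff field_simps)
  define \<pi> where "\<pi> p = (\<Prod>i\<in>{n' - m + 1..n'}. p i :: real)" for p
  have [measurable]: "\<pi> \<in> borel_measurable P"
    unfolding P_def \<pi>_def by (intro borel_measurable_prod) (auto intro!: measurable_component_singleton[of _ _ "\<lambda>i. chi2 i s", simplified])
  let ?h = "\<lambda>r q. \<integral>\<^sup>+p. \<integral>\<^sup>+b. \<integral>\<^sup>+x. f (complex_of_real (r * ((x + q * b) * \<pi> p)))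
      \<partial>chi2 (n' - m) s \<partial>beta_dist a (m / 2) \<partial>P"
  have "gint (Suc (Suc m)) (Suc n') (corner t) f = (\<integral>\<^sup>+r. \<integral>\<^sup>+u. ?h r (t\<^sup>2 * u) \<partial>beta_dist (n' / 2) (1 / 2) \<partial>chi2 (Suc n') s)"
  proof (rule gint_recursion[where h = ?h])
    fix r w q :: real assume eq: "r * q = r * w\<^sup>2"
    have *: "complex_of_real r * complex_of_real ((x + w\<^sup>2 * b) * y) = complex_of_real (r * ((x + q * b) * y))" for x b y
    proof -
      have "r * ((x + w\<^sup>2 * b) * y) = (r * x + r * w\<^sup>2 * b) * y" by (simp add: algebra_simps)
      also have "\<dots> = r * ((x + q * b) * y)" unfolding eq[symmetric] by (simp add: algebra_simps)
      finally show ?thesis by (simp only: of_real_mult[symmetric])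
    qed
    have "gint (Suc m) n' (corner w) (\<lambda>z. f (complex_of_real r * z)) = law m n' (w\<^sup>2) (\<lambda>z. f (complex_of_real r * z))"
      by (rule Suc.IH) (use n' in auto)
    then show "gint (Suc m) n' (corner w) (\<lambda>z. f (complex_of_real r * z)) = ?h r q"
      by (simp only: law_def * a_def P_def \<pi>_def)
  next
    show "(\<lambda>(r, u). ?h r u) \<in> borel_measurable (borel \<Otimes>\<^sub>M borel)" by measurable
  qed (use n' in auto)
  \<comment> \<open>The integral over \<open>u\<close> is moved past the chi-square variables to
    stand next to that over \<open>b\<close>.\<close>
  also have "\<dots> = (\<integral>\<^sup>+r. \<integral>\<^sup>+p. \<integral>\<^sup>+u. \<integral>\<^sup>+b. \<integral>\<^sup>+x. f (complex_of_real (r * ((x + t\<^sup>2 * u * b) * \<pi> p)))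
      \<partial>chi2 (n' - m) s \<partial>beta_dist a (m / 2) \<partial>beta_dist (n' / 2) (1 / 2) \<partial>P \<partial>chi2 (Suc n') s)"
    by (rule nn_integral_cong, rule PB.Fubini') measurable
  also have "\<dots> = (\<integral>\<^sup>+r. \<integral>\<^sup>+p. \<integral>\<^sup>+b. \<integral>\<^sup>+x. f (complex_of_real (r * ((x + t\<^sup>2 * b) * \<pi> p)))
      \<partial>chi2 (n' - m) s \<partial>beta_dist a (m / 2 + 1 / 2) \<partial>P \<partial>chi2 (Suc n') s)"
  proof -
    have "(\<integral>\<^sup>+u. \<integral>\<^sup>+b. \<integral>\<^sup>+x. f (complex_of_real (r * ((x + t\<^sup>2 * u * b) * y)))
        \<partial>chi2 (n' - m) s \<partial>beta_dist a (m / 2) \<partial>beta_dist (n' / 2) (1 / 2))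
      = (\<integral>\<^sup>+b. \<integral>\<^sup>+x. f (complex_of_real (r * ((x + t\<^sup>2 * b) * y))) \<partial>chi2 (n' - m) s \<partial>beta_dist a (m / 2 + 1 / 2))" for r y
      using nn_integral_beta_beta[of a "m / 2" "1 / 2" "\<lambda>b. \<integral>\<^sup>+x. f (complex_of_real (r * ((x + t\<^sup>2 * b) * y))) \<partial>chi2 (n' - m) s"]
        a Suc.hyps by (simp add: mult.assoc)
    then show ?thesis by simp
  qed
  also have "\<dots> = law (Suc m) n (t\<^sup>2) f"
  proof -
    \<comment> \<open>Because \<open>n - Suc m = n' - m\<close>, the lower end of the index range,
      the isolated chi-square variable and the parameter \<open>a\<close> are the same as for
      \<open>n'\<close>; only the degree \<open>Suc n'\<close> is new.\<close>
    have ins: "{n - Suc m + 1..n} = insert (Suc n') {n' - m + 1..n'}" using n' by auto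
    let ?F = "\<lambda>p. \<integral>\<^sup>+b. \<integral>\<^sup>+x. f (complex_of_real ((x + t\<^sup>2 * b) * (\<Prod>i\<in>insert (Suc n') {n' - m + 1..n'}. p i)))
      \<partial>chi2 (n' - m) s \<partial>beta_dist a (m / 2 + 1 / 2)"
    have [measurable]: "(\<lambda>p. \<Prod>i\<in>insert (Suc n') {n' - m + 1..n'}. p i :: real)
        \<in> borel_measurable (PiM (insert (Suc n') {n' - m + 1..n'}) (\<lambda>i. chi2 i s))"
      by (intro borel_measurable_prod) (auto intro!: measurable_component_singleton[of _ _ "\<lambda>i. chi2 i s", simplified])
    have "law (Suc m) n (t\<^sup>2) f = (\<integral>\<^sup>+p. ?F p \<partial>PiM (insert (Suc n') {n' - m + 1..n'}) (\<lambda>i. chi2 i s))"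
      unfolding law_def ins by (simp add: n' a_def add_divide_distrib add.commute)
    also have "\<dots> = (\<integral>\<^sup>+r. \<integral>\<^sup>+p. ?F (p(Suc n' := r)) \<partial>P \<partial>chi2 (Suc n') s)"
      unfolding P_def by (rule chi.product_nn_integral_insert_rev) (simp, simp, measurable)
    also have "\<dots> = (\<integral>\<^sup>+r. \<integral>\<^sup>+p. \<integral>\<^sup>+b. \<integral>\<^sup>+x. f (complex_of_real (r * ((x + t\<^sup>2 * b) * \<pi> p)))
      \<partial>chi2 (n' - m) s \<partial>beta_dist a (m / 2 + 1 / 2) \<partial>P \<partial>chi2 (Suc n') s)"
    proof -
      have "(\<Prod>i\<in>insert (Suc n') {n' - m + 1..n'}. (p(Suc n' := r)) i) = r * \<pi> p" for p r
        unfolding \<pi>_def by (subst prod.insert) (auto intro!: prod.cong)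
      then have "(x + t\<^sup>2 * b) * (\<Prod>i\<in>insert (Suc n') {n' - m + 1..n'}. (p(Suc n' := r)) i)
          = r * ((x + t\<^sup>2 * b) * \<pi> p)" for x b p r
        by (simp only: mult.left_commute)
      then show ?thesis by (simp only:)
    qed
    finally show ?thesis ..
  qed
  finally show ?case by (simp add: n')
qed

subsection \<open>The law of the right-hand side\<close>

text \<open>Coordinates 0 and 1 of the product are split off by Fubini. The others, numbered in
  \<open>rhs_law\<close> by position, are renumbered by degrees of freedom to match
  \<open>law\<close>.\<close>

lemma nn_integral_rhs_law:
  assumes m: "m \<ge> 1" "n > m" and f [measurable]: "f \<in> borel_measurable borel"
  shows "(\<integral>\<^sup>+y. f (complex_of_real y) \<partial>rhs_law (Suc m) n s) = law m n (real n * real (Suc m)) f"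
proof -
  define M where "M = (\<lambda>i. if i = 0 then chi2 (n - Suc m + 1) s
     else if i = 1 then beta_dist ((real (n - Suc m) + 1) / 2) ((real (Suc m) - 1) / 2)
     else chi2 (n - (i - 1) + 1) s)"
  have [simp]: "sets (M i) = sets borel" for i by (simp add: M_def)
  then have [measurable_cong]: "sets (M 0) = sets borel" "sets (M 1) = sets borel" by auto
  have prob: "prob_space (M i)" for i
    using m by (auto simp: M_def intro: prob_space_chi2 prob_space_beta_dist)
  interpret M: product_prob_space M "{}"
    by (intro product_prob_spaceI prob)
  interpret M0: prob_space "M 0" by (rule prob)
  interpret M1: prob_space "M 1" by (rule prob)
  have M01: "M 0 = chi2 (n - m) s" "M (Suc 0) = beta_dist (real (n - m) / 2) (m / 2)"
    using m by (auto simp: M_def Suc_diff_Suc of_nat_diff)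
  have coord: "(\<lambda>y. y i) \<in> borel_measurable (PiM I M)" if "i \<in> I" for i I
    by (subst measurable_cong_sets[OF refl, of borel "M i"]) (auto intro: measurable_component_singleton that)
  define J where "J = {2..Suc m}"
  define \<pi> where "\<pi> y = (\<Prod>i\<in>{1..m}. y (i + 1) :: real)" for y
  define q where "q = real n * real (Suc m)"
  have I: "{..Suc m} = insert 0 (insert 1 J)" using m by (auto simp: J_def)
  have J: "finite J" "1 \<notin> J" "finite (insert 1 J)" "0 \<notin> insert 1 J" by (auto simp: J_def)
  have \<pi>_meas: "\<pi> \<in> borel_measurable (PiM I M)" if "J \<subseteq> I" for I
    unfolding \<pi>_def using that by (intro borel_measurable_prod coord) (auto simp: J_def)
  have \<pi>_upd: "\<pi> (y(i := x)) = \<pi> y" if "i \<in> {0, 1}" for y i x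
    unfolding \<pi>_def using that by (intro prod.cong) auto
  have [measurable]: "\<pi> \<in> borel_measurable (PiM J M)" "\<pi> \<in> borel_measurable (PiM (insert 1 J) M)"
      "\<pi> \<in> borel_measurable (PiM (insert 0 (insert 1 J)) M)"
    by (rule \<pi>_meas; blast)+
  \<comment> \<open>Named projections, so that their measurability can be declared on each of the
    index sets met below.\<close>
  define e0 e1 :: "(nat \<Rightarrow> real) \<Rightarrow> real" where "e0 y = y 0" and "e1 y = y 1" for y
  have [measurable]: "e0 \<in> borel_measurable (PiM (insert 0 (insert 1 J)) M)"
      "e1 \<in> borel_measurable (PiM (insert 0 (insert 1 J)) M)"
      "e1 \<in> borel_measurable (PiM (insert 1 J) M)"
    unfolding e0_def[abs_def] e1_def[abs_def] by (rule coord; blast)+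
  have "(\<integral>\<^sup>+y. f (complex_of_real y) \<partial>rhs_law (Suc m) n s)
      = (\<integral>\<^sup>+y. f (complex_of_real ((e0 y + q * e1 y) * \<pi> y)) \<partial>PiM (insert 0 (insert 1 J)) M)"
    unfolding rhs_law_def M_def[symmetric] I diff_Suc_1 \<pi>_def[symmetric] q_def[symmetric]
      e0_def[symmetric] e1_def[symmetric]
    by (rule nn_integral_distr) measurable
  also have "\<dots> = (\<integral>\<^sup>+y. \<integral>\<^sup>+x. f (complex_of_real ((e0 (y(0 := x)) + q * e1 (y(0 := x))) * \<pi> (y(0 := x))))
      \<partial>M 0 \<partial>PiM (insert 1 J) M)"
    by (rule M.product_nn_integral_insert[OF J(3,4)]) measurable
  also have "\<dots> = (\<integral>\<^sup>+y. \<integral>\<^sup>+x. f (complex_of_real ((x + q * e1 y) * \<pi> y)) \<partial>M 0 \<partial>PiM (insert 1 J) M)"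
    by (simp add: \<pi>_upd e0_def e1_def)
  also have "\<dots> = (\<integral>\<^sup>+y. \<integral>\<^sup>+b. \<integral>\<^sup>+x. f (complex_of_real ((x + q * e1 (y(1 := b))) * \<pi> (y(1 := b))))
      \<partial>M 0 \<partial>M 1 \<partial>PiM J M)"
    by (rule M.product_nn_integral_insert[OF J(1,2)]) measurable
  also have "\<dots> = (\<integral>\<^sup>+y. \<integral>\<^sup>+b. \<integral>\<^sup>+x. f (complex_of_real ((x + q * b) * \<pi> y)) \<partial>M 0 \<partial>M 1 \<partial>PiM J M)"
    by (simp add: \<pi>_upd e0_def e1_def)
  also have "\<dots> = law m n q f"
  proof -
    \<comment> \<open>Position \<open>i\<close> carries \<open>n + 2 - i\<close> degrees of freedom:
      the positions from 2 to \<open>m + 1\<close> run through \<open>n\<close> down to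
      \<open>n - m + 1\<close>.\<close>
    define g where "g i = n - (i - 1) + 1" for i :: nat
    have inj: "inj_on g J" using m by (auto simp: inj_on_def g_def J_def)
    have img: "bij_betw g J {n - m + 1..n}"
      using m by (intro bij_betwI[where g = "\<lambda>j. n + 2 - j"]) (auto simp: g_def J_def)
    have PJ: "PiM J M = PiM J (\<lambda>i. chi2 (g i) s)"
      by (intro PiM_cong) (auto simp: M_def g_def J_def)
    let ?K = "PiM {n - m + 1..n} (\<lambda>i. chi2 i s)"
    have r: "distr ?K (PiM J M) (\<lambda>w. \<lambda>i\<in>J. w (g i)) = PiM J M"
      unfolding PJ using img by (intro distr_PiM_reindex prob_space_chi2 inj) (auto simp: bij_betw_def)
    have rm: "(\<lambda>w. \<lambda>i\<in>J. w (g i)) \<in> measurable ?K (PiM J M)"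
      unfolding PJ using img by (intro measurable_restrict measurable_component_singleton) (auto simp: bij_betw_def)
    have pr: "\<pi> (\<lambda>i\<in>J. w (g i)) = (\<Prod>j\<in>{n - m + 1..n}. w j)" for w
    proof -
      have "\<pi> (\<lambda>i\<in>J. w (g i)) = (\<Prod>i\<in>{1..m}. w (g (i + 1)))"
        unfolding \<pi>_def by (intro prod.cong) (auto simp: J_def)
      also have "\<dots> = (\<Prod>i\<in>J. w (g i))"
        by (rule prod.reindex_bij_witness[of _ "\<lambda>i. i - 1" "\<lambda>i. i + 1"]) (auto simp: J_def)
      also have "\<dots> = (\<Prod>j\<in>{n - m + 1..n}. w j)"
        by (rule prod.reindex_bij_betw[OF img])
      finally show ?thesis .
    qed
    have "(\<integral>\<^sup>+y. \<integral>\<^sup>+b. \<integral>\<^sup>+x. f (complex_of_real ((x + q * b) * \<pi> y)) \<partial>M 0 \<partial>M 1 \<partial>PiM J M)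
      = (\<integral>\<^sup>+y. \<integral>\<^sup>+b. \<integral>\<^sup>+x. f (complex_of_real ((x + q * b) * \<pi> y)) \<partial>M 0 \<partial>M 1 \<partial>distr ?K (PiM J M) (\<lambda>w. \<lambda>i\<in>J. w (g i)))"
      unfolding r ..
    also have "\<dots> = (\<integral>\<^sup>+w. \<integral>\<^sup>+b. \<integral>\<^sup>+x. f (complex_of_real ((x + q * b) * \<pi> (\<lambda>i\<in>J. w (g i)))) \<partial>M 0 \<partial>M 1 \<partial>?K)"
      by (rule nn_integral_distr[OF rm]) measurable
    also have "\<dots> = law m n q f"
      unfolding law_def pr by (simp add: M01)
    finally show ?thesis .
  qed
  finally show ?thesis unfolding q_def .
qed

lemma Phi_law_gauss: "Phi_law m n s = gauss (grid m n)"
  by (simp add: Phi_law_def grid_def)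

lemma gint_ones_rhs_law:
  assumes "2 \<le> m" "m \<le> n" and f [measurable]: "f \<in> borel_measurable borel"
  shows "gint m n (\<lambda>_. 1) f = (\<integral>\<^sup>+y. f (complex_of_real y) \<partial>rhs_law m n s)"
proof -
  obtain k where k: "m = Suc k" "k \<ge> 1" using assms by (cases m) auto
  obtain t where t: "t\<^sup>2 = real n * real m" "gint m n (\<lambda>_. 1) f = gint m n (corner t) f"
    by (rule gint_ones[of m n f]) (use assms in auto)
  show ?thesis
    using gint_corner[of k n f t] nn_integral_rhs_law[of k n f] assms k t by simp
qed

end

section \<open>From integrals of test functions to equality of laws\<close>

lemma distr_eqI:
  fixes g :: "'a \<Rightarrow> complex" and h :: "'b \<Rightarrow> complex"
  assumes [measurable]: "g \<in> borel_measurable M" "h \<in> borel_measurable N"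
    and eq: "\<And>f. f \<in> borel_measurable borel \<Longrightarrow> (\<integral>\<^sup>+x. f (g x) \<partial>M) = (\<integral>\<^sup>+y. f (h y) \<partial>N)"
  shows "distr M borel g = distr N borel h"
proof (rule measure_eqI)
  fix X assume "X \<in> sets (distr M borel g)"
  then have [measurable]: "X \<in> sets borel" by simp
  have "emeasure (distr M borel g) X = (\<integral>\<^sup>+z. indicator X z \<partial>distr M borel g)" by simp
  also have "\<dots> = (\<integral>\<^sup>+x. indicator X (g x) \<partial>M)" by (rule nn_integral_distr) auto
  also have "\<dots> = (\<integral>\<^sup>+y. indicator X (h y) \<partial>N)" by (rule eq) simp
  also have "\<dots> = (\<integral>\<^sup>+z. indicator X z \<partial>distr N borel h)" by (rule nn_integral_distr[symmetric]) auto
  also have "\<dots> = emeasure (distr N borel h) X" by simp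
  finally show "emeasure (distr M borel g) X = emeasure (distr N borel h) X" .
qed simp

lemma mat_adjoint_index:
  "i < dim_col A \<Longrightarrow> j < dim_row A \<Longrightarrow> mat_adjoint A $$ (i, j) = conjugate (A $$ (j, i))"
  by (simp add: mat_adjoint_def mat_of_rows_def)

lemma mat_adjoint_dim [simp]: "dim_row (mat_adjoint A) = dim_col A" "dim_col (mat_adjoint A) = dim_row A"
  by (simp_all add: mat_adjoint_def mat_of_rows_def)

lemma Theta_mult_adjoint: "Theta m n \<Phi> * mat_adjoint (Theta m n \<Phi>) = gram m n (\<lambda>_. 1) \<Phi>"
  by (rule eq_matI)
    (auto simp: Theta_def gram_def scalar_prod_def mat_adjoint_index entry_def lessThan_atLeast0 intro!: sum.cong)

text \<open>With the adjoint on the left the conjugate falls on the other factor, so the Gram matrix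
  of the transposed array appears transposed; the determinant does not see this.\<close>

lemma adjoint_mult_Theta:
  "mat_adjoint (Theta m n \<Phi>) * Theta m n \<Phi> = transpose_mat (gram n m (\<lambda>_. 1) (\<Phi> \<circ> prod.swap))"
  by (rule eq_matI)
    (auto simp: Theta_def gram_def scalar_prod_def mat_adjoint_index entry_def lessThan_atLeast0 mult.commute intro!: sum.cong)

theorem theorem6:
  fixes s :: real and MR MT :: nat
  assumes "s > 0"
  shows "(2 \<le> MR \<and> MR \<le> MT \<longrightarrow>
           distr (Phi_law MR MT s) borel
             (\<lambda>\<Phi>. det (Theta MR MT \<Phi> * mat_adjoint (Theta MR MT \<Phi>)))
         = distr (rhs_law MR MT s) borel complex_of_real)
       \<and> (2 \<le> MT \<and> MT < MR \<longrightarrow>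
           distr (Phi_law MR MT s) borel
             (\<lambda>\<Phi>. det (mat_adjoint (Theta MR MT \<Phi>) * Theta MR MT \<Phi>))
         = distr (rhs_law MT MR s) borel complex_of_real)"
proof -
  interpret gaussian s by unfold_locales fact
  have "complex_of_real \<in> borel_measurable (rhs_law m n s)" for m n
    by (simp add: rhs_law_def)
  note * = distr_eqI[OF _ this]
  have "distr (Phi_law MR MT s) borel (\<lambda>\<Phi>. det (Theta MR MT \<Phi> * mat_adjoint (Theta MR MT \<Phi>)))
      = distr (rhs_law MR MT s) borel complex_of_real" if "2 \<le> MR" "MR \<le> MT"
    unfolding Phi_law_gauss Theta_mult_adjoint gdet_def[symmetric]
    by (rule *) (use gint_ones_rhs_law[OF that] in \<open>auto simp: gint_def\<close>)
  \<comment> \<open>By \<open>gint_swap\<close> the transposed Gaussian array gives the same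
    integrals, so the first case applies with \<open>MT\<close> and \<open>MR\<close>
    exchanged.\<close>
  moreover have "distr (Phi_law MR MT s) borel (\<lambda>\<Phi>. det (mat_adjoint (Theta MR MT \<Phi>) * Theta MR MT \<Phi>))
      = distr (rhs_law MT MR s) borel complex_of_real" if "2 \<le> MT" "MT < MR"
    unfolding Phi_law_gauss adjoint_mult_Theta det_transpose[OF gram_carrier] gdet_def[symmetric]
    by (rule *) (use gint_ones_rhs_law[of MT MR] that in \<open>auto simp: gint_swap[symmetric]\<close>)
  ultimately show ?thesis by blast
qed

end
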